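(* For every formula $A$ of $\mathbf{IQC}$: if $\vdash_{\mathbf{EQC}} A^{\Box_{\mathbf{RS}}}$ then $\vdash_{\mathbf{IQC}} A$. Likewise, for every formula $A$ of the language of arithmetic: if $\vdash_{\mathbf{EA}} A^{\Box_{\mathbf{RS}}}$ then $\vdash_{\mathbf{HA}} A$.
   Context: $\mathbf{IQC}$ is intuitionistic first-order predicate calculus with equality, with primitives $\vee,\wedge,\supset,\exists,\forall$ and the constant $\bot$; $\neg A$ abbreviates $A\supset\bot$. $\mathbf{EQC}$ is classical first-order predicate calculus with equality extended by a modal operator $\Box$ governed by the S4 rules ($\Box$-introduction: from $A$ infer $\Box A$ provided all open assumptions have the form $\Box B$; $\Box$-elimination: from $\Box A$ infer $A$); no Barcan formula is assumed. $\mathbf{HA}$ is Heyting arithmetic (language $0,s,+,\cdot$; axioms for zero and successor, defining equations of $+,\cdot$, induction for all formulas) over $\mathbf{IQC}$. $\mathbf{EA}$ (Shapiro's epistemic arithmetic) is the same arithmetic axioms, with induction for all formulas of the modal language, over $\mathbf{EQC}$ (i.e. $\mathbf{PA}$ plus S4). The modified Rasiowa–Sikorski translation $A\mapsto A^{\Box_{\mathbf{RS}}}$ is defined by induction on $A$: (i) if $A$ is $\bot$ or an equation $s=t$, $A^{\Box_{\mathbf{RS}}}=A$; (ii) if $A$ is any other atomic formula, $A^{\Box_{\mathbf{RS}}}=\Box A$; (iii) $(A\vee B)^{\Box_{\mathbf{RS}}}=\Box A^{\Box_{\mathbf{RS}}}\vee\Box B^{\Box_{\mathbf{RS}}}$;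 (iv) $(A\wedge B)^{\Box_{\mathbf{RS}}}=A^{\Box_{\mathbf{RS}}}\wedge B^{\Box_{\mathbf{RS}}}$; (v) $(A\supset B)^{\Box_{\mathbf{RS}}}=\Box(\Box A^{\Box_{\mathbf{RS}}}\supset\Box B^{\Box_{\mathbf{RS}}})$; (vi) $(\exists x A)^{\Box_{\mathbf{RS}}}=\exists x\,\Box A^{\Box_{\mathbf{RS}}}$; (vii) $(\forall x A)^{\Box_{\mathbf{RS}}}=\forall x\,A^{\Box_{\mathbf{RS}}}$. *)

theory Defs
  imports Main
begin

text \<open>
  Bound variables are de Bruijn indices; free variables are the indices that point beyond all
  enclosing quantifiers. A language is a pair of sets of symbols tagged with their arities. The
  raw datatypes below do not enforce arities; this is done by the predicates \<open>wf_tm\<close>,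
  \<open>wf_fm\<close>, \<open>wf_mfm\<close>, which carve out the terms and formulas of a given language.
\<close>

type_synonym ('f, 'p) lang = "('f \<times> nat) set \<times> ('p \<times> nat) set"

datatype 'f tm = Var nat | Fun 'f "'f tm list"

datatype ('f, 'p) fm =
    Bot
  | Eq "'f tm" "'f tm"
  | Pred 'p "'f tm list"
  | Or "('f, 'p) fm" "('f, 'p) fm"
  | And "('f, 'p) fm" "('f, 'p) fm"
  | Imp "('f, 'p) fm" "('f, 'p) fm"
  | Ex "('f, 'p) fm"
  | All "('f, 'p) fm"

datatype ('f, 'p) mfm =
    MBot
  | MEq "'f tm" "'f tm"
  | MPred 'p "'f tm list"
  | MOr "('f, 'p) mfm" "('f, 'p) mfm"
  | MAnd "('f, 'p) mfm" "('f, 'p) mfm"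
  | MImp "('f, 'p) mfm" "('f, 'p) mfm"
  | MEx "('f, 'p) mfm"
  | MAll "('f, 'p) mfm"
  | Box "('f, 'p) mfm"

abbreviation Neg :: "('f, 'p) fm \<Rightarrow> ('f, 'p) fm" where
  "Neg A \<equiv> Imp A Bot"

abbreviation MNeg :: "('f, 'p) mfm \<Rightarrow> ('f, 'p) mfm" where
  "MNeg A \<equiv> MImp A MBot"

primrec wf_tm :: "('f, 'p) lang \<Rightarrow> 'f tm \<Rightarrow> bool" where
  "wf_tm L (Var n) \<longleftrightarrow> True"
| "wf_tm L (Fun f ts) \<longleftrightarrow> (f, length ts) \<in> fst L \<and> list_all (wf_tm L) ts"

primrec wf_fm :: "('f, 'p) lang \<Rightarrow> ('f, 'p) fm \<Rightarrow> bool" where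
  "wf_fm L Bot \<longleftrightarrow> True"
| "wf_fm L (Eq s t) \<longleftrightarrow> wf_tm L s \<and> wf_tm L t"
| "wf_fm L (Pred p ts) \<longleftrightarrow> (p, length ts) \<in> snd L \<and> list_all (wf_tm L) ts"
| "wf_fm L (Or A B) \<longleftrightarrow> wf_fm L A \<and> wf_fm L B"
| "wf_fm L (And A B) \<longleftrightarrow> wf_fm L A \<and> wf_fm L B"
| "wf_fm L (Imp A B) \<longleftrightarrow> wf_fm L A \<and> wf_fm L B"
| "wf_fm L (Ex A) \<longleftrightarrow> wf_fm L A"
| "wf_fm L (All A) \<longleftrightarrow> wf_fm L A"

primrec wf_mfm :: "('f, 'p) lang \<Rightarrow> ('f, 'p) mfm \<Rightarrow> bool" where
  "wf_mfm L MBot \<longleftrightarrow> True"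
| "wf_mfm L (MEq s t) \<longleftrightarrow> wf_tm L s \<and> wf_tm L t"
| "wf_mfm L (MPred p ts) \<longleftrightarrow> (p, length ts) \<in> snd L \<and> list_all (wf_tm L) ts"
| "wf_mfm L (MOr A B) \<longleftrightarrow> wf_mfm L A \<and> wf_mfm L B"
| "wf_mfm L (MAnd A B) \<longleftrightarrow> wf_mfm L A \<and> wf_mfm L B"
| "wf_mfm L (MImp A B) \<longleftrightarrow> wf_mfm L A \<and> wf_mfm L B"
| "wf_mfm L (MEx A) \<longleftrightarrow> wf_mfm L A"
| "wf_mfm L (MAll A) \<longleftrightarrow> wf_mfm L A"
| "wf_mfm L (Box A) \<longleftrightarrow> wf_mfm L A"

text \<open>Simultaneous, capture-avoiding substitution of terms for the free variables.\<close>

primrec subst_tm :: "(nat \<Rightarrow> 'f tm) \<Rightarrow> 'f tm \<Rightarrow> 'f tm" where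
  "subst_tm \<sigma> (Var n) = \<sigma> n"
| "subst_tm \<sigma> (Fun f ts) = Fun f (map (subst_tm \<sigma>) ts)"

definition shift :: "nat \<Rightarrow> 'f tm" where
  "shift n = Var (Suc n)"

text \<open>The substitution to be used below a quantifier: index 0 is bound there.\<close>

definition up :: "(nat \<Rightarrow> 'f tm) \<Rightarrow> nat \<Rightarrow> 'f tm" where
  "up \<sigma> n = (case n of 0 \<Rightarrow> Var 0 | Suc m \<Rightarrow> subst_tm shift (\<sigma> m))"

primrec subst_fm :: "(nat \<Rightarrow> 'f tm) \<Rightarrow> ('f, 'p) fm \<Rightarrow> ('f, 'p) fm" where
  "subst_fm \<sigma> Bot = Bot"
| "subst_fm \<sigma> (Eq s t) = Eq (subst_tm \<sigma> s) (subst_tm \<sigma> t)"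
| "subst_fm \<sigma> (Pred p ts) = Pred p (map (subst_tm \<sigma>) ts)"
| "subst_fm \<sigma> (Or A B) = Or (subst_fm \<sigma> A) (subst_fm \<sigma> B)"
| "subst_fm \<sigma> (And A B) = And (subst_fm \<sigma> A) (subst_fm \<sigma> B)"
| "subst_fm \<sigma> (Imp A B) = Imp (subst_fm \<sigma> A) (subst_fm \<sigma> B)"
| "subst_fm \<sigma> (Ex A) = Ex (subst_fm (up \<sigma>) A)"
| "subst_fm \<sigma> (All A) = All (subst_fm (up \<sigma>) A)"

primrec subst_mfm :: "(nat \<Rightarrow> 'f tm) \<Rightarrow> ('f, 'p) mfm \<Rightarrow> ('f, 'p) mfm" where
  "subst_mfm \<sigma> MBot = MBot"
| "subst_mfm \<sigma> (MEq s t) = MEq (subst_tm \<sigma> s) (subst_tm \<sigma> t)"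
| "subst_mfm \<sigma> (MPred p ts) = MPred p (map (subst_tm \<sigma>) ts)"
| "subst_mfm \<sigma> (MOr A B) = MOr (subst_mfm \<sigma> A) (subst_mfm \<sigma> B)"
| "subst_mfm \<sigma> (MAnd A B) = MAnd (subst_mfm \<sigma> A) (subst_mfm \<sigma> B)"
| "subst_mfm \<sigma> (MImp A B) = MImp (subst_mfm \<sigma> A) (subst_mfm \<sigma> B)"
| "subst_mfm \<sigma> (MEx A) = MEx (subst_mfm (up \<sigma>) A)"
| "subst_mfm \<sigma> (MAll A) = MAll (subst_mfm (up \<sigma>) A)"
| "subst_mfm \<sigma> (Box A) = Box (subst_mfm \<sigma> A)"

text \<open>Instantiation of the outermost bound variable (index 0) of a quantifier body by \<open>t\<close>.\<close>

definition inst :: "'f tm \<Rightarrow> nat \<Rightarrow> 'f tm" where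
  "inst t n = (case n of 0 \<Rightarrow> t | Suc m \<Rightarrow> Var m)"

text \<open>
  Both calculi are parametrized by the language \<open>L\<close> and a set \<open>Ax\<close> of non-logical axioms;
  the context \<open>\<Gamma>\<close> contains (at least) the open assumptions. The well-formedness premises keep
  all formulas of a derivation inside \<open>L\<close>. The eigenvariable of \<open>AllI\<close> and \<open>ExE\<close> is index 0,
  fresh because everything else is shifted; since axioms are not part of the context, those with
  free variables may be generalized.
\<close>

inductive ideriv :: "('f, 'p) lang \<Rightarrow> ('f, 'p) fm set \<Rightarrow> ('f, 'p) fm set \<Rightarrow> ('f, 'p) fm \<Rightarrow> bool"
  for L :: "('f, 'p) lang" and Ax :: "('f, 'p) fm set" where
  Axiom: "A \<in> Ax \<Longrightarrow> ideriv L Ax \<Gamma> A"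
| Assm: "A \<in> \<Gamma> \<Longrightarrow> wf_fm L A \<Longrightarrow> ideriv L Ax \<Gamma> A"
| BotE: "ideriv L Ax \<Gamma> Bot \<Longrightarrow> wf_fm L A \<Longrightarrow> ideriv L Ax \<Gamma> A"
| OrI1: "ideriv L Ax \<Gamma> A \<Longrightarrow> wf_fm L B \<Longrightarrow> ideriv L Ax \<Gamma> (Or A B)"
| OrI2: "ideriv L Ax \<Gamma> B \<Longrightarrow> wf_fm L A \<Longrightarrow> ideriv L Ax \<Gamma> (Or A B)"
| OrE: "ideriv L Ax \<Gamma> (Or A B) \<Longrightarrow> ideriv L Ax (insert A \<Gamma>) C \<Longrightarrow>
    ideriv L Ax (insert B \<Gamma>) C \<Longrightarrow> ideriv L Ax \<Gamma> C"
| AndI: "ideriv L Ax \<Gamma> A \<Longrightarrow> ideriv L Ax \<Gamma> B \<Longrightarrow> ideriv L Ax \<Gamma> (And A B)"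
| AndE1: "ideriv L Ax \<Gamma> (And A B) \<Longrightarrow> ideriv L Ax \<Gamma> A"
| AndE2: "ideriv L Ax \<Gamma> (And A B) \<Longrightarrow> ideriv L Ax \<Gamma> B"
| ImpI: "ideriv L Ax (insert A \<Gamma>) B \<Longrightarrow> wf_fm L A \<Longrightarrow> ideriv L Ax \<Gamma> (Imp A B)"
| ImpE: "ideriv L Ax \<Gamma> (Imp A B) \<Longrightarrow> ideriv L Ax \<Gamma> A \<Longrightarrow> ideriv L Ax \<Gamma> B"
| ExI: "ideriv L Ax \<Gamma> (subst_fm (inst t) A) \<Longrightarrow> wf_tm L t \<Longrightarrow> ideriv L Ax \<Gamma> (Ex A)"
| ExE: "ideriv L Ax \<Gamma> (Ex A) \<Longrightarrow>
    ideriv L Ax (insert A (subst_fm shift ` \<Gamma>)) (subst_fm shift C) \<Longrightarrow> ideriv L Ax \<Gamma> C"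
| AllI: "ideriv L Ax (subst_fm shift ` \<Gamma>) A \<Longrightarrow> ideriv L Ax \<Gamma> (All A)"
| AllE: "ideriv L Ax \<Gamma> (All A) \<Longrightarrow> wf_tm L t \<Longrightarrow> ideriv L Ax \<Gamma> (subst_fm (inst t) A)"
| EqRefl: "wf_tm L t \<Longrightarrow> ideriv L Ax \<Gamma> (Eq t t)"
| EqSubst: "ideriv L Ax \<Gamma> (Eq s t) \<Longrightarrow> ideriv L Ax \<Gamma> (subst_fm (inst s) A) \<Longrightarrow>
    ideriv L Ax \<Gamma> (subst_fm (inst t) A)"

text \<open>
  \<open>MRaa\<close> is classical reductio ad absurdum; it subsumes ex falso. In \<open>MEqSubst\<close> the formula
  \<open>A\<close> may contain \<open>Box\<close>. In \<open>BoxI\<close> the set \<open>Box ` \<Delta>\<close> consists of the assumptions on which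
  the premise depends; \<open>\<Gamma>\<close> may contain further, unused ones.
\<close>

inductive mderiv :: "('f, 'p) lang \<Rightarrow> ('f, 'p) mfm set \<Rightarrow> ('f, 'p) mfm set \<Rightarrow> ('f, 'p) mfm \<Rightarrow> bool"
  for L :: "('f, 'p) lang" and Ax :: "('f, 'p) mfm set" where
  MAxiom: "A \<in> Ax \<Longrightarrow> mderiv L Ax \<Gamma> A"
| MAssm: "A \<in> \<Gamma> \<Longrightarrow> wf_mfm L A \<Longrightarrow> mderiv L Ax \<Gamma> A"
| MRaa: "mderiv L Ax (insert (MNeg A) \<Gamma>) MBot \<Longrightarrow> wf_mfm L A \<Longrightarrow> mderiv L Ax \<Gamma> A"
| MOrI1: "mderiv L Ax \<Gamma> A \<Longrightarrow> wf_mfm L B \<Longrightarrow> mderiv L Ax \<Gamma> (MOr A B)"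
| MOrI2: "mderiv L Ax \<Gamma> B \<Longrightarrow> wf_mfm L A \<Longrightarrow> mderiv L Ax \<Gamma> (MOr A B)"
| MOrE: "mderiv L Ax \<Gamma> (MOr A B) \<Longrightarrow> mderiv L Ax (insert A \<Gamma>) C \<Longrightarrow>
    mderiv L Ax (insert B \<Gamma>) C \<Longrightarrow> mderiv L Ax \<Gamma> C"
| MAndI: "mderiv L Ax \<Gamma> A \<Longrightarrow> mderiv L Ax \<Gamma> B \<Longrightarrow> mderiv L Ax \<Gamma> (MAnd A B)"
| MAndE1: "mderiv L Ax \<Gamma> (MAnd A B) \<Longrightarrow> mderiv L Ax \<Gamma> A"
| MAndE2: "mderiv L Ax \<Gamma> (MAnd A B) \<Longrightarrow> mderiv L Ax \<Gamma> B"
| MImpI: "mderiv L Ax (insert A \<Gamma>) B \<Longrightarrow> wf_mfm L A \<Longrightarrow> mderiv L Ax \<Gamma> (MImp A B)"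
| MImpE: "mderiv L Ax \<Gamma> (MImp A B) \<Longrightarrow> mderiv L Ax \<Gamma> A \<Longrightarrow> mderiv L Ax \<Gamma> B"
| MExI: "mderiv L Ax \<Gamma> (subst_mfm (inst t) A) \<Longrightarrow> wf_tm L t \<Longrightarrow> mderiv L Ax \<Gamma> (MEx A)"
| MExE: "mderiv L Ax \<Gamma> (MEx A) \<Longrightarrow>
    mderiv L Ax (insert A (subst_mfm shift ` \<Gamma>)) (subst_mfm shift C) \<Longrightarrow> mderiv L Ax \<Gamma> C"
| MAllI: "mderiv L Ax (subst_mfm shift ` \<Gamma>) A \<Longrightarrow> mderiv L Ax \<Gamma> (MAll A)"
| MAllE: "mderiv L Ax \<Gamma> (MAll A) \<Longrightarrow> wf_tm L t \<Longrightarrow> mderiv L Ax \<Gamma> (subst_mfm (inst t) A)"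
| MEqRefl: "wf_tm L t \<Longrightarrow> mderiv L Ax \<Gamma> (MEq t t)"
| MEqSubst: "mderiv L Ax \<Gamma> (MEq s t) \<Longrightarrow> mderiv L Ax \<Gamma> (subst_mfm (inst s) A) \<Longrightarrow>
    mderiv L Ax \<Gamma> (subst_mfm (inst t) A)"
| BoxI: "mderiv L Ax (Box ` \<Delta>) A \<Longrightarrow> Box ` \<Delta> \<subseteq> \<Gamma> \<Longrightarrow> mderiv L Ax \<Gamma> (Box A)"
| BoxE: "mderiv L Ax \<Gamma> (Box A) \<Longrightarrow> mderiv L Ax \<Gamma> A"

definition IQC :: "('f, 'p) lang \<Rightarrow> ('f, 'p) fm \<Rightarrow> bool" where
  "IQC L A \<longleftrightarrow> ideriv L {} {} A"

definition EQC :: "('f, 'p) lang \<Rightarrow> ('f, 'p) mfm \<Rightarrow> bool" where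
  "EQC L A \<longleftrightarrow> mderiv L {} {} A"

datatype arith_fun = FZero | FSuc | FAdd | FMul

text \<open>
  There are no predicate symbols besides equality. As HOL types are nonempty, the type
  \<open>unit\<close> stands in for the names of predicate symbols.
\<close>

definition arith_lang :: "(arith_fun, unit) lang" where
  "arith_lang = ({(FZero, 0), (FSuc, 1), (FAdd, 2), (FMul, 2)}, {})"

abbreviation zero :: "arith_fun tm" where
  "zero \<equiv> Fun FZero []"

abbreviation succ :: "arith_fun tm \<Rightarrow> arith_fun tm" where
  "succ t \<equiv> Fun FSuc [t]"

abbreviation add :: "arith_fun tm \<Rightarrow> arith_fun tm \<Rightarrow> arith_fun tm" where
  "add s t \<equiv> Fun FAdd [s, t]"

abbreviation mul :: "arith_fun tm \<Rightarrow> arith_fun tm \<Rightarrow> arith_fun tm" where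
  "mul s t \<equiv> Fun FMul [s, t]"

text \<open>Replaces the variable 0 by its successor and leaves all other variables unchanged.\<close>

definition step :: "nat \<Rightarrow> arith_fun tm" where
  "step n = (case n of 0 \<Rightarrow> succ (Var 0) | Suc m \<Rightarrow> Var (Suc m))"

text \<open>In the induction schema, \<open>A\<close> may have parameters (free variables other than index 0).\<close>

inductive_set HA_axioms :: "(arith_fun, unit) fm set" where
  "All (Neg (Eq (succ (Var 0)) zero)) \<in> HA_axioms"
| "All (All (Imp (Eq (succ (Var 1)) (succ (Var 0))) (Eq (Var 1) (Var 0)))) \<in> HA_axioms"
| "All (Eq (add (Var 0) zero) (Var 0)) \<in> HA_axioms"
| "All (All (Eq (add (Var 1) (succ (Var 0))) (succ (add (Var 1) (Var 0))))) \<in> HA_axioms"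
| "All (Eq (mul (Var 0) zero) zero) \<in> HA_axioms"
| "All (All (Eq (mul (Var 1) (succ (Var 0))) (add (mul (Var 1) (Var 0)) (Var 1)))) \<in> HA_axioms"
| "wf_fm arith_lang A \<Longrightarrow>
    Imp (And (subst_fm (inst zero) A) (All (Imp A (subst_fm step A)))) (All A) \<in> HA_axioms"

inductive_set EA_axioms :: "(arith_fun, unit) mfm set" where
  "MAll (MNeg (MEq (succ (Var 0)) zero)) \<in> EA_axioms"
| "MAll (MAll (MImp (MEq (succ (Var 1)) (succ (Var 0))) (MEq (Var 1) (Var 0)))) \<in> EA_axioms"
| "MAll (MEq (add (Var 0) zero) (Var 0)) \<in> EA_axioms"
| "MAll (MAll (MEq (add (Var 1) (succ (Var 0))) (succ (add (Var 1) (Var 0))))) \<in> EA_axioms"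
| "MAll (MEq (mul (Var 0) zero) zero) \<in> EA_axioms"
| "MAll (MAll (MEq (mul (Var 1) (succ (Var 0))) (add (mul (Var 1) (Var 0)) (Var 1)))) \<in> EA_axioms"
| "wf_mfm arith_lang A \<Longrightarrow>
    MImp (MAnd (subst_mfm (inst zero) A) (MAll (MImp A (subst_mfm step A)))) (MAll A) \<in> EA_axioms"

definition HA :: "(arith_fun, unit) fm \<Rightarrow> bool" where
  "HA A \<longleftrightarrow> ideriv arith_lang HA_axioms {} A"

definition EA :: "(arith_fun, unit) mfm \<Rightarrow> bool" where
  "EA A \<longleftrightarrow> mderiv arith_lang EA_axioms {} A"

primrec rs :: "('f, 'p) fm \<Rightarrow> ('f, 'p) mfm" where
  "rs Bot = MBot"
| "rs (Eq s t) = MEq s t"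
| "rs (Pred p ts) = Box (MPred p ts)"
| "rs (Or A B) = MOr (Box (rs A)) (Box (rs B))"
| "rs (And A B) = MAnd (rs A) (rs B)"
| "rs (Imp A B) = Box (MImp (Box (rs A)) (Box (rs B)))"
| "rs (Ex A) = MEx (Box (rs A))"
| "rs (All A) = MAll (rs A)"

end

theory Submission imports Defs
begin

text \<open>
  The proof adapts the method of Flagg and Friedman. Read a modal formula in a Kripke frame whose
  worlds are intuitionistic formulas \<open>E\<close> and in which every world sees every other: at
  world \<open>E\<close> the connectives are those of the double negation translation with
  \<open>\<bottom>\<close> replaced by \<open>E\<close>, and \<open>Box A\<close> is the double
  negation, relative to \<open>E\<close>, of ``\<open>A\<close> holds at all worlds''. This interprets
  classical S4 in intuitionistic logic and sends induction axioms to induction axioms.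

  To have ``at all worlds'' expressible, take as worlds only the substitution instances of the
  subformulas of the given formula and of \<open>\<bottom>\<close>; then it is a finite conjunction of
  universal closures. Every subformula \<open>A\<close> is equivalent to ``\<open>rs A\<close> holds at all
  worlds'': for the nontrivial direction evaluate at the world \<open>A\<close> itself (at \<open>B\<close>
  inside an implication \<open>A \<longrightarrow> B\<close>), because \<open>(A \<longrightarrow> A) \<longrightarrow> A\<close> gives
  \<open>A\<close>.
\<close>

section \<open>Substitutions and their composition\<close>

definition scomp :: "(nat \<Rightarrow> 'f tm) \<Rightarrow> (nat \<Rightarrow> 'f tm) \<Rightarrow> nat \<Rightarrow> 'f tm" (infixl \<open>\<odot>\<close> 70) where
  "(\<sigma> \<odot> \<tau>) n = subst_tm \<sigma> (\<tau> n)"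

definition shiftn :: "nat \<Rightarrow> nat \<Rightarrow> 'f tm" where
  "shiftn n k = Var (k + n)"

text \<open>The substitution by which \<open>allsE\<close> strips a whole block of \<open>n\<close>
  quantifiers. It cancels the shift \<open>shiftn n\<close> that such a block imposes on everything
  outside it.\<close>

definition instn :: "nat \<Rightarrow> (nat \<Rightarrow> 'f tm) \<Rightarrow> nat \<Rightarrow> 'f tm" where
  "instn n \<tau> k = (if k < n then \<tau> k else Var (k - n))"

lemma up_simps [simp]: "up \<sigma> 0 = Var 0" "up \<sigma> (Suc n) = subst_tm shift (\<sigma> n)"
  by (simp_all add: up_def)

lemma inst_simps [simp]: "inst t 0 = t" "inst t (Suc n) = Var n"
  by (simp_all add: inst_def)

lemma shift_apply [simp]: "shift n = Var (Suc n)"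
  by (simp add: shift_def)

lemma subst_tm_scomp [simp]: "subst_tm \<sigma> (subst_tm \<tau> t) = subst_tm (\<sigma> \<odot> \<tau>) t"
  by (induction t) (auto simp: scomp_def)

lemma subst_tm_comp [simp]: "subst_tm \<sigma> \<circ> subst_tm \<tau> = subst_tm (\<sigma> \<odot> \<tau>)"
  by auto

lemma subst_tm_Var [simp]: "subst_tm Var t = t"
  by (induction t) (auto simp: map_idI)

lemma scomp_assoc [simp]: "\<sigma> \<odot> (\<tau> \<odot> \<rho>) = (\<sigma> \<odot> \<tau>) \<odot> \<rho>"
  by (rule ext) (simp add: scomp_def[of _ "_ \<odot> _"] scomp_def[of _ \<rho>])

lemma scomp_Var [simp]: "\<sigma> \<odot> Var = \<sigma>" "Var \<odot> \<sigma> = \<sigma>"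
  by (auto simp: scomp_def)

lemma up_shift: "up \<sigma> \<odot> shift = shift \<odot> \<sigma>"
  by (rule ext) (simp add: scomp_def)

lemma inst_shift [simp]: "inst t \<odot> shift = Var"
  by (rule ext) (simp add: scomp_def)

text \<open>A shifted quantified formula, instantiated at the eigenvariable \<open>Var 0\<close>,
  gives back its own body. This is how bodies are recovered inside \<open>AllI\<close> and
  \<open>ExE\<close>.\<close>

lemma inst_up_shift [simp]: "inst (Var 0) \<odot> up shift = Var"
proof
  show "(inst (Var 0) \<odot> up shift) n = Var n" for n :: nat
    by (cases n) (auto simp: scomp_def)
qed

lemma up_scomp [simp]: "up \<sigma> \<odot> up \<tau> = up (\<sigma> \<odot> \<tau>)"
proof
  show "(up \<sigma> \<odot> up \<tau>) n = up (\<sigma> \<odot> \<tau>) n" for n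
    by (cases n) (auto simp: scomp_def[of _ "up _"] scomp_def[of _ \<tau>] up_shift)
qed

lemma inst_up_shift_scomp [simp]: "inst (Var 0) \<odot> up (shift \<odot> \<sigma>) = up \<sigma>"
  by (metis inst_up_shift scomp_Var(2) scomp_assoc up_scomp)

lemma up_Var [simp]: "up Var = Var"
proof
  show "up Var n = Var n" for n
    by (cases n) auto
qed

lemma subst_fm_scomp [simp]: "subst_fm \<sigma> (subst_fm \<tau> A) = subst_fm (\<sigma> \<odot> \<tau>) A"
  by (induction A arbitrary: \<sigma> \<tau>) auto

lemma subst_fm_Var [simp]: "subst_fm Var A = A"
  by (induction A) (auto simp: map_idI)

lemma instn_shiftn [simp]: "instn n \<tau> \<odot> shiftn n = Var"
  by (rule ext) (simp add: scomp_def instn_def shiftn_def)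

lemma scomp_inst: "\<sigma> \<odot> inst t = inst (subst_tm \<sigma> t) \<odot> up \<sigma>"
proof
  show "(\<sigma> \<odot> inst t) n = (inst (subst_tm \<sigma> t) \<odot> up \<sigma>) n" for n
    by (cases n) (auto simp: scomp_def[of _ "up _"] scomp_def[of _ "inst _"])
qed

lemma shift_shiftn: "shift \<odot> shiftn n = shiftn (Suc n)"
  by (rule ext) (simp add: scomp_def shiftn_def)

lemma shiftn_0 [simp]: "shiftn 0 = Var"
  by (rule ext) (simp add: shiftn_def)

text \<open>Below \<open>n\<close> binders a substitution is the identity on the \<open>n\<close>
  bound indices, so it fixes a formula whose variables all lie below \<open>n\<close>;
  \<open>subst_up_Fs\<close> rests on this.\<close>

lemma up_funpow: "(up ^^ n) \<tau> k = (if k < n then Var k else subst_tm (shiftn n) (\<tau> (k - n)))"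
proof (induction n arbitrary: k)
  case (Suc n)
  then show ?case
    by (cases k) (simp_all add: shift_shiftn)
qed simp

lemma up_funpow_shiftn: "(up ^^ n) \<tau> \<odot> shiftn n = shiftn n \<odot> \<tau>"
  by (rule ext) (simp add: scomp_def shiftn_def up_funpow)

section \<open>Bounds on free variables\<close>

text \<open>For \<open>f\<close> of the form \<open>\<lambda>\<sigma>. subst_fm \<sigma> A\<close>
  this says that the free variables of \<open>A\<close> lie below \<open>N\<close>. Agreement of
  substitutions is the form in which the bound is applied, and it spares a separate notion of free
  variable.\<close>

definition free_below :: "nat \<Rightarrow> ((nat \<Rightarrow> 'f tm) \<Rightarrow> 'a) \<Rightarrow> bool" where
  "free_below N f \<longleftrightarrow> (\<forall>\<sigma> \<tau>. (\<forall>k<N. \<sigma> k = \<tau> k) \<longrightarrow> f \<sigma> = f \<tau>)"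

lemma free_belowD: "free_below N f \<Longrightarrow> (\<And>k. k < N \<Longrightarrow> \<sigma> k = \<tau> k) \<Longrightarrow> f \<sigma> = f \<tau>"
  by (simp add: free_below_def)

lemma free_below_mono: "free_below M f \<Longrightarrow> M \<le> N \<Longrightarrow> free_below N f"
  by (simp add: free_below_def)

lemma free_below_common:
  assumes "\<And>x. x \<in> set xs \<Longrightarrow> \<exists>N. free_below N (f x)"
  shows "\<exists>N. \<forall>x\<in>set xs. free_below N (f x)"
  using assms
proof (induction xs)
  case (Cons x xs)
  obtain M where M: "free_below M (f x)"
    using Cons.prems[of x] by auto
  obtain N where N: "\<forall>x\<in>set xs. free_below N (f x)"
    using Cons by auto
  show ?case
    using M N by (intro exI[of _ "max M N"]) (auto intro: free_below_mono)
qed simp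

lemma ex_free_below_tm: "\<exists>N. free_below N (\<lambda>\<sigma>. subst_tm \<sigma> t)"
proof (induction t)
  case (Var n)
  then show ?case by (intro exI[of _ "Suc n"]) (simp add: free_below_def)
next
  case (Fun f ts)
  obtain N where N: "\<forall>t\<in>set ts. free_below N (\<lambda>\<sigma>. subst_tm \<sigma> t)"
    using free_below_common[of ts "\<lambda>t \<sigma>. subst_tm \<sigma> t", OF Fun.IH] by auto
  show ?case
    using N by (intro exI[of _ N]) (simp add: free_below_def)
qed

lemma up_cong: "\<forall>k<N. \<sigma> k = \<tau> k \<Longrightarrow> k < N \<Longrightarrow> up \<sigma> k = up \<tau> k"
  by (cases k) auto

text \<open>The bound for the body serves again, if not sharply: \<open>up \<sigma> k\<close>
  consults \<sigma> only below \<open>k\<close>.\<close>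

lemma ex_free_below_up:
  assumes "\<exists>N. free_below N f"
  shows "\<exists>N. free_below N (\<lambda>\<sigma>. f (up \<sigma>))"
proof -
  obtain N where N: "free_below N f"
    using assms by blast
  have "free_below N (\<lambda>\<sigma>. f (up \<sigma>))"
    unfolding free_below_def
  proof (intro allI impI)
    show "f (up \<sigma>) = f (up \<tau>)" if "\<forall>k<N. \<sigma> k = \<tau> k" for \<sigma> \<tau>
      by (rule free_belowD[OF N]) (rule up_cong[OF that])
  qed
  then show ?thesis
    by (rule exI)
qed

lemma ex_free_below_comp2:
  assumes "\<exists>N. free_below N f" "\<exists>N. free_below N g"
  shows "\<exists>N. free_below N (\<lambda>\<sigma>. h (f \<sigma>) (g \<sigma>))"
proof -
  obtain M N where "free_below M f" "free_below N g"
    using assms by blast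
  then have "free_below (max M N) f" "free_below (max M N) g"
    by (auto intro: free_below_mono)
  then have "free_below (max M N) (\<lambda>\<sigma>. h (f \<sigma>) (g \<sigma>))"
    unfolding free_below_def by (intro allI impI arg_cong2[of _ _ _ _ h]) simp_all
  then show ?thesis
    by (rule exI)
qed

lemma ex_free_below_comp: "\<exists>N. free_below N f \<Longrightarrow> \<exists>N. free_below N (\<lambda>\<sigma>. h (f \<sigma>))"
  using ex_free_below_comp2[of f f "\<lambda>x _. h x"] by simp

lemma ex_free_below_fm: "\<exists>N. free_below N (\<lambda>\<sigma>. subst_fm \<sigma> A)"
proof (induction A)
  case (Pred p ts)
  \<comment> \<open>Packing the arguments into one term under an arbitrary function symbol gives a
    common bound for all of them.\<close>
  have "\<exists>N. free_below N (\<lambda>\<sigma>. subst_tm \<sigma> (Fun undefined ts))"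
    by (rule ex_free_below_tm)
  then show ?case
    by (simp add: free_below_def)
next
  case (Ex A)
  show ?case
    using ex_free_below_comp[OF ex_free_below_up[OF Ex], of Ex] by simp
next
  case (All A)
  show ?case
    using ex_free_below_comp[OF ex_free_below_up[OF All], of All] by simp
qed (simp_all add: ex_free_below_tm ex_free_below_comp2[where h = Eq]
    ex_free_below_comp2[where h = Or] ex_free_below_comp2[where h = And]
    ex_free_below_comp2[where h = Imp], simp add: free_below_def)

section \<open>Well-formedness and weakening\<close>

definition wf_subst :: "('f, 'p) lang \<Rightarrow> (nat \<Rightarrow> 'f tm) \<Rightarrow> bool" where
  "wf_subst L \<sigma> \<longleftrightarrow> (\<forall>n. wf_tm L (\<sigma> n))"

lemma wf_subst_tm [simp]: "wf_subst L \<sigma> \<Longrightarrow> wf_tm L t \<Longrightarrow> wf_tm L (subst_tm \<sigma> t)"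
  by (induction t) (auto simp: wf_subst_def list_all_iff)

lemma wf_subst_scomp [simp]: "wf_subst L \<sigma> \<Longrightarrow> wf_subst L \<tau> \<Longrightarrow> wf_subst L (\<sigma> \<odot> \<tau>)"
  using wf_subst_tm by (auto simp: wf_subst_def scomp_def)

lemma wf_subst_simps [simp]:
  "wf_subst L Var" "wf_subst L shift" "wf_subst L (shiftn n)"
  "wf_tm L t \<Longrightarrow> wf_subst L (inst t)"
  by (auto simp: wf_subst_def shiftn_def inst_def split: nat.split)

lemma wf_subst_up [simp]: "wf_subst L \<sigma> \<Longrightarrow> wf_subst L (up \<sigma>)"
proof -
  assume \<sigma>: "wf_subst L \<sigma>"
  have "wf_tm L (up \<sigma> n)" for n
    using \<sigma> by (cases n) (auto simp: wf_subst_def)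
  then show ?thesis
    by (simp add: wf_subst_def)
qed

lemma wf_subst_fm [simp]: "wf_subst L \<sigma> \<Longrightarrow> wf_fm L A \<Longrightarrow> wf_fm L (subst_fm \<sigma> A)"
  by (induction A arbitrary: \<sigma>) (auto simp: list_all_iff)

lemma wf_subst_mfm [simp]: "wf_subst L \<sigma> \<Longrightarrow> wf_mfm L A \<Longrightarrow> wf_mfm L (subst_mfm \<sigma> A)"
  by (induction A arbitrary: \<sigma>) (auto simp: list_all_iff)

lemma wf_subst_tmD: "wf_tm L (subst_tm \<sigma> t) \<Longrightarrow> wf_tm L t"
  by (induction t) (auto simp: list_all_iff)

text \<open>Substitution removes no function or predicate symbol. In \<open>ExI\<close>,
  \<open>ExE\<close> and \<open>EqSubst\<close> this recovers the well-formedness of a formula that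
  is known only through an instance.\<close>

lemma wf_subst_fmD: "wf_fm L (subst_fm \<sigma> A) \<Longrightarrow> wf_fm L A"
  by (induction A arbitrary: \<sigma>) (auto simp: list_all_iff intro: wf_subst_tmD)

lemma wf_subst_mfmD: "wf_mfm L (subst_mfm \<sigma> A) \<Longrightarrow> wf_mfm L A"
  by (induction A arbitrary: \<sigma>) (auto simp: list_all_iff intro: wf_subst_tmD)

lemma ideriv_wf: "ideriv L Ax \<Gamma> A \<Longrightarrow> \<forall>B\<in>Ax. wf_fm L B \<Longrightarrow> wf_fm L A"
  by (induction rule: ideriv.induct) (auto dest: wf_subst_fmD)

lemma mderiv_wf: "mderiv L Ax \<Gamma> A \<Longrightarrow> \<forall>B\<in>Ax. wf_mfm L B \<Longrightarrow> wf_mfm L A"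
  by (induction rule: mderiv.induct) (auto dest: wf_subst_mfmD)

lemma ideriv_mono: "ideriv L Ax \<Gamma> A \<Longrightarrow> \<Gamma> \<subseteq> \<Delta> \<Longrightarrow> ideriv L Ax \<Delta> A"
proof (induction arbitrary: \<Delta> rule: ideriv.induct)
  case (OrE \<Gamma> A B C)
  show ?case
    by (rule ideriv.OrE[OF OrE.IH(1)[OF OrE.prems] OrE.IH(2,3)[OF insert_mono[OF OrE.prems]]])
next
  case (ExE \<Gamma> A C)
  show ?case
    by (rule ideriv.ExE[OF ExE.IH(1)[OF ExE.prems] ExE.IH(2)[OF insert_mono[OF image_mono[OF ExE.prems]]]])
next
  case (ImpI A \<Gamma> B)
  show ?case
    by (rule ideriv.ImpI[OF ImpI.IH[OF insert_mono[OF ImpI.prems]] ImpI.hyps(2)])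
next
  case (AllI \<Gamma> A)
  show ?case
    by (rule ideriv.AllI[OF AllI.IH[OF image_mono[OF AllI.prems]]])
next
  case (EqSubst \<Gamma> s t A)
  show ?case
    by (rule ideriv.EqSubst[OF EqSubst.IH(1,2)[OF EqSubst.prems]])
next
  case (ExI \<Gamma> t A)
  show ?case
    by (rule ideriv.ExI[OF ExI.IH[OF ExI.prems] ExI.hyps(2)])
next
  case (AllE \<Gamma> A t)
  show ?case
    by (rule ideriv.AllE[OF AllE.IH[OF AllE.prems] AllE.hyps(2)])
next
  case (AndE1 \<Gamma> A B)
  show ?case
    by (rule ideriv.AndE1[OF AndE1.IH[OF AndE1.prems]])
next
  case (AndE2 \<Gamma> A B)
  show ?case
    by (rule ideriv.AndE2[OF AndE2.IH[OF AndE2.prems]])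
next
  case (ImpE \<Gamma> A B)
  show ?case
    by (rule ideriv.ImpE[OF ImpE.IH[OF ImpE.prems]])
qed (simp_all add: ideriv.Axiom ideriv.Assm ideriv.BotE ideriv.OrI1 ideriv.OrI2 ideriv.AndI
    ideriv.EqRefl subsetD)

section \<open>Relative double negation, finite conjunctions and universal closures\<close>

definition dn :: "('f, 'p) fm \<Rightarrow> ('f, 'p) fm \<Rightarrow> ('f, 'p) fm" where
  "dn E A = Imp (Imp A E) E"

definition conjs :: "('f, 'p) fm list \<Rightarrow> ('f, 'p) fm" where
  "conjs As = foldr And As (Imp Bot Bot)"

definition alls :: "nat \<Rightarrow> ('f, 'p) fm \<Rightarrow> ('f, 'p) fm" where
  "alls n A = (All ^^ n) A"

lemma alls_simps: "alls 0 A = A" "alls (Suc n) A = alls n (All A)"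
  by (simp_all add: alls_def funpow_swap1)

lemma subst_dn [simp]: "subst_fm \<sigma> (dn E A) = dn (subst_fm \<sigma> E) (subst_fm \<sigma> A)"
  by (simp add: dn_def)

lemma subst_conjs [simp]: "subst_fm \<sigma> (conjs As) = conjs (map (subst_fm \<sigma>) As)"
  by (induction As) (simp_all add: conjs_def)

lemma subst_alls [simp]: "subst_fm \<sigma> (alls n A) = alls n (subst_fm ((up ^^ n) \<sigma>) A)"
  by (induction n arbitrary: A) (simp_all add: alls_simps)

lemma wf_dn [simp]: "wf_fm L (dn E A) \<longleftrightarrow> wf_fm L E \<and> wf_fm L A"
  by (auto simp: dn_def)

lemma wf_conjs [simp]: "wf_fm L (conjs As) \<longleftrightarrow> (\<forall>A\<in>set As. wf_fm L A)"
  by (induction As) (simp_all add: conjs_def)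

lemma wf_alls [simp]: "wf_fm L (alls n A) \<longleftrightarrow> wf_fm L A"
  by (induction n arbitrary: A) (simp_all add: alls_simps)

text \<open>
  All variables of \<open>F \<in> set Fs\<close> lie below \<open>N\<close>, so \<open>N\<close> quantifiers
  bind them all. The substitution argument of \<open>tr\<close> below exists because these quantifiers
  must not capture the variables of the formula being translated; applying it as a separate
  substitution first would break primitive recursion.
\<close>

locale relative_translation =
  fixes L :: "('f, 'p) lang" and Ax :: "('f, 'p) fm set"
    and Fs :: "('f, 'p) fm list" and N :: nat
  assumes wf_Ax: "\<forall>A\<in>Ax. wf_fm L A"
    and wf_Fs: "F \<in> set Fs \<Longrightarrow> wf_fm L F"
    and free_Fs: "F \<in> set Fs \<Longrightarrow> free_below N (\<lambda>\<sigma>. subst_fm \<sigma> F)"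
begin

section \<open>Derived rules of the intuitionistic calculus\<close>

abbreviation deriv :: "('f, 'p) fm set \<Rightarrow> ('f, 'p) fm \<Rightarrow> bool" (infix \<open>\<turnstile>\<close> 50) where
  "\<Gamma> \<turnstile> A \<equiv> ideriv L Ax \<Gamma> A"

lemma wf: "\<Gamma> \<turnstile> A \<Longrightarrow> wf_fm L A"
  using ideriv_wf wf_Ax by blast

lemma weaken: "\<Gamma> \<turnstile> A \<Longrightarrow> \<Gamma> \<subseteq> \<Delta> \<Longrightarrow> \<Delta> \<turnstile> A"
  by (rule ideriv_mono)

lemma cut:
  assumes "\<Gamma> \<turnstile> A" "insert A \<Gamma> \<turnstile> B"
  shows "\<Gamma> \<turnstile> B"
  using ImpE[OF ImpI[OF assms(2) wf[OF assms(1)]] assms(1)] .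

lemma cut1:
  assumes "\<Gamma> \<turnstile> A" "{A} \<turnstile> B"
  shows "\<Gamma> \<turnstile> B"
  using assms(1) weaken[OF assms(2)] by (rule cut) simp

lemma cut_finite:
  assumes "finite \<Delta>" "\<And>A. A \<in> \<Delta> \<Longrightarrow> \<Gamma> \<turnstile> A" "\<Gamma> \<union> \<Delta> \<turnstile> B"
  shows "\<Gamma> \<turnstile> B"
  using assms
proof (induction \<Delta> rule: finite_induct)
  case (insert A \<Delta>)
  have "\<Gamma> \<union> \<Delta> \<turnstile> A"
    using insert.prems(1)[of A] by (rule weaken) auto
  moreover have "insert A (\<Gamma> \<union> \<Delta>) \<turnstile> B"
    using insert.prems(2) by simp
  ultimately have "\<Gamma> \<union> \<Delta> \<turnstile> B"
    by (rule cut)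
  then show ?case
    using insert.IH insert.prems(1) by simp
qed simp

lemma dnI: "\<Gamma> \<turnstile> A \<Longrightarrow> wf_fm L E \<Longrightarrow> \<Gamma> \<turnstile> dn E A"
  unfolding dn_def
  by (rule ImpI[OF ImpE[OF Assm weaken]]) (auto dest: wf)

lemma hyp: "wf_fm L A \<Longrightarrow> insert A \<Gamma> \<turnstile> A"
  by (simp add: Assm)

lemma dnE:
  assumes "\<Gamma> \<turnstile> dn E A" "insert A \<Gamma> \<turnstile> E"
  shows "\<Gamma> \<turnstile> E"
  using ImpE[OF assms(1)[unfolded dn_def] ImpI[OF assms(2)]] wf[OF assms(1)] by simp

text \<open>\<open>dn E\<close> behaves like a monad: a hypothesis under \<open>dn E\<close> may be
  used unwrapped as long as the goal is under \<open>dn E\<close> too. Once \<open>Imp B E\<close>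
  is assumed, the goal is \<open>E\<close>, and there \<open>dnE\<close> applies.\<close>

lemma dn_bind:
  assumes "\<Gamma> \<turnstile> dn E A" "insert A \<Gamma> \<turnstile> dn E B"
  shows "\<Gamma> \<turnstile> dn E B"
proof -
  let ?\<Delta> = "insert (Imp B E) \<Gamma>"
  have wf: "wf_fm L A" "wf_fm L B" "wf_fm L E"
    using assms by (auto dest: wf)
  have "insert A ?\<Delta> \<turnstile> Imp (Imp B E) E"
    using assms(2) unfolding dn_def by (rule weaken) auto
  then have "insert A ?\<Delta> \<turnstile> E"
    by (rule ImpE) (simp add: Assm wf)
  moreover have "?\<Delta> \<turnstile> dn E A"
    using assms(1) by (rule weaken) auto
  ultimately have "?\<Delta> \<turnstile> E"
    by (blast intro: dnE)
  then show ?thesis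
    unfolding dn_def by (rule ImpI) (simp add: wf)
qed

lemma dn_bind_finite:
  assumes "finite \<Delta>" "\<And>A. A \<in> \<Delta> \<Longrightarrow> \<Gamma> \<turnstile> dn E A" "\<Gamma> \<union> \<Delta> \<turnstile> dn E B"
  shows "\<Gamma> \<turnstile> dn E B"
  using assms
proof (induction \<Delta> rule: finite_induct)
  case (insert A \<Delta>)
  have "\<Gamma> \<union> \<Delta> \<turnstile> dn E A"
    using insert.prems(1)[of A] by (rule weaken) auto
  moreover have "insert A (\<Gamma> \<union> \<Delta>) \<turnstile> dn E B"
    using insert.prems(2) by simp
  ultimately have "\<Gamma> \<union> \<Delta> \<turnstile> dn E B"
    by (rule dn_bind)
  then show ?case
    using insert.IH insert.prems(1) by simp
qed simp

lemma dn_dn: "wf_fm L E \<Longrightarrow> wf_fm L A \<Longrightarrow> {dn E (dn E A)} \<turnstile> dn E A"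
  by (rule dn_bind[OF hyp hyp]) simp_all

text \<open>The premise \<open>Imp E E\<close> of this double negation is a tautology. Evaluating at
  a well chosen world produces such a formula, and here the double negation disappears.\<close>

lemma dn_self: "\<Gamma> \<turnstile> dn E E \<Longrightarrow> \<Gamma> \<turnstile> E"
  using dnE[OF _ hyp, of \<Gamma> E] wf[of \<Gamma> "dn E E"] by simp

lemma conjs_iff: "\<Gamma> \<turnstile> conjs As \<longleftrightarrow> (\<forall>A\<in>set As. \<Gamma> \<turnstile> A)"
  by (induction As) (auto simp: conjs_def intro: ImpI[OF hyp] AndI AndE1 AndE2)

lemma allsI: "subst_fm (shiftn n) ` \<Gamma> \<turnstile> A \<Longrightarrow> \<Gamma> \<turnstile> alls n A"
proof (induction n arbitrary: \<Gamma> A)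
  case (Suc n)
  have "subst_fm (shiftn n) ` \<Gamma> \<turnstile> All A"
    using Suc.prems by (intro AllI) (simp add: image_image shift_shiftn)
  then show ?case
    by (simp add: alls_simps Suc.IH)
qed (simp add: alls_simps)

lemma instn_Suc: "instn (Suc n) \<tau> = inst (\<tau> 0) \<odot> up (instn n (\<lambda>k. \<tau> (Suc k)))"
proof
  fix k
  show "instn (Suc n) \<tau> k = (inst (\<tau> 0) \<odot> up (instn n (\<lambda>k. \<tau> (Suc k)))) k"
    by (cases k) (auto simp: scomp_def[of _ "up _"] instn_def)
qed

lemma allsE: "\<Gamma> \<turnstile> alls n A \<Longrightarrow> wf_subst L \<tau> \<Longrightarrow> \<Gamma> \<turnstile> subst_fm (instn n \<tau>) A"
proof (induction n arbitrary: \<tau> A)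
  case 0
  have "instn 0 \<tau> = Var"
    by (rule ext) (simp add: instn_def)
  then show ?case
    using 0 by (simp add: alls_simps)
next
  case (Suc n)
  let ?\<tau> = "\<lambda>k. \<tau> (Suc k)"
  have "\<Gamma> \<turnstile> subst_fm (instn n ?\<tau>) (All A)"
    using Suc.prems by (intro Suc.IH) (simp_all add: alls_simps wf_subst_def)
  then have "\<Gamma> \<turnstile> subst_fm (inst (\<tau> 0)) (subst_fm (up (instn n ?\<tau>)) A)"
    using Suc.prems(2) by (intro AllE) (simp_all add: wf_subst_def)
  then show ?case
    by (simp add: instn_Suc)
qed

section \<open>The translation and its stability\<close>

primrec tr :: "('f, 'p) mfm \<Rightarrow> (nat \<Rightarrow> 'f tm) \<Rightarrow> ('f, 'p) fm \<Rightarrow> ('f, 'p) fm" where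
  "tr MBot \<sigma> E = E"
| "tr (MEq s t) \<sigma> E = dn E (Eq (subst_tm \<sigma> s) (subst_tm \<sigma> t))"
| "tr (MPred p ts) \<sigma> E = dn E (Pred p (map (subst_tm \<sigma>) ts))"
| "tr (MOr A B) \<sigma> E = dn E (Or (tr A \<sigma> E) (tr B \<sigma> E))"
| "tr (MAnd A B) \<sigma> E = And (tr A \<sigma> E) (tr B \<sigma> E)"
| "tr (MImp A B) \<sigma> E = Imp (tr A \<sigma> E) (tr B \<sigma> E)"
| "tr (MEx A) \<sigma> E = dn E (Ex (tr A (up \<sigma>) (subst_fm shift E)))"
| "tr (MAll A) \<sigma> E = All (tr A (up \<sigma>) (subst_fm shift E))"
| "tr (Box A) \<sigma> E = dn E (conjs (map (\<lambda>F. alls N (tr A (shiftn N \<odot> \<sigma>) F)) Fs))"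

text \<open>The part of the \<open>Box\<close> clause that does not mention the current world. From
  here on \<open>tr_Box\<close> replaces that clause in the simpset, so that the conjunction over
  worlds stays folded.\<close>

definition everywhere :: "('f, 'p) mfm \<Rightarrow> (nat \<Rightarrow> 'f tm) \<Rightarrow> ('f, 'p) fm" where
  "everywhere A \<sigma> = conjs (map (\<lambda>F. alls N (tr A (shiftn N \<odot> \<sigma>) F)) Fs)"

lemma tr_Box [simp]: "tr (Box A) \<sigma> E = dn E (everywhere A \<sigma>)"
  by (simp add: everywhere_def)

declare tr.simps(9) [simp del]

lemma subst_Fs: "F \<in> set Fs \<Longrightarrow> (\<And>k. k < N \<Longrightarrow> \<sigma> k = Var k) \<Longrightarrow> subst_fm \<sigma> F = F"
  using free_belowD[OF free_Fs, of F \<sigma> Var] by simp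

lemma subst_up_Fs: "F \<in> set Fs \<Longrightarrow> subst_fm ((up ^^ N) \<tau>) F = F"
  by (rule subst_Fs) (simp_all add: up_funpow)

text \<open>In the \<open>Box\<close> case \<tau> passes under \<open>N\<close> quantifiers. There
  it fixes every \<open>F\<close> in \<open>Fs\<close>, whose variables are all bound, and it
  commutes with \<open>shiftn N\<close>.\<close>

lemma subst_tr: "subst_fm \<tau> (tr A \<sigma> E) = tr A (\<tau> \<odot> \<sigma>) (subst_fm \<tau> E)"
proof (induction A arbitrary: \<sigma> \<tau> E)
  case (Box A)
  then show ?case
    by (simp add: everywhere_def up_funpow_shiftn subst_up_Fs comp_def cong: map_cong)
qed (simp_all add: up_shift)

lemma subst_everywhere: "subst_fm \<tau> (everywhere A \<sigma>) = everywhere A (\<tau> \<odot> \<sigma>)"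
  by (simp add: everywhere_def up_funpow_shiftn subst_tr subst_up_Fs comp_def cong: map_cong)

lemma tr_subst: "tr (subst_mfm \<tau> A) \<sigma> E = tr A (\<sigma> \<odot> \<tau>) E"
  by (induction A arbitrary: \<sigma> \<tau> E) (simp_all add: everywhere_def)

text \<open>The world is shifted when the translation enters a quantifier, and \<open>inst\<close>
  undoes that shift. Hence translations of instances are instances of a single formula, as the
  quantifier and equality rules require.\<close>

lemma tr_inst: "tr (subst_mfm (inst t) A) \<sigma> E = subst_fm (inst (subst_tm \<sigma> t)) (tr A (up \<sigma>) (subst_fm shift E))"
  by (simp add: tr_subst subst_tr scomp_inst)

lemma tr_shift: "tr (subst_mfm shift A) (up \<sigma>) (subst_fm shift E) = subst_fm shift (tr A \<sigma> E)"
  by (simp add: tr_subst subst_tr up_shift)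

lemma wf_tr [simp]: "wf_mfm L A \<Longrightarrow> wf_subst L \<sigma> \<Longrightarrow> wf_fm L E \<Longrightarrow> wf_fm L (tr A \<sigma> E)"
  by (induction A arbitrary: \<sigma> E) (auto simp: everywhere_def list_all_iff wf_Fs)

lemma wf_everywhere [simp]: "wf_mfm L A \<Longrightarrow> wf_subst L \<sigma> \<Longrightarrow> wf_fm L (everywhere A \<sigma>)"
  by (auto simp: everywhere_def wf_Fs)

text \<open>This makes classical reductio sound. Conjunction, implication and universal
  quantification inherit stability from their parts; the other clauses yield \<open>E\<close> itself
  or a formula already of the form \<open>dn E A\<close>.\<close>

lemma tr_stable:
  "wf_mfm L A \<Longrightarrow> wf_subst L \<sigma> \<Longrightarrow> wf_fm L E \<Longrightarrow> {dn E (tr A \<sigma> E)} \<turnstile> tr A \<sigma> E"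
proof (induction A arbitrary: \<sigma> E)
  case (MAnd A B)
  let ?C = "And (tr A \<sigma> E) (tr B \<sigma> E)"
  let ?\<Gamma> = "{dn E ?C}"
  have wf: "wf_fm L (tr A \<sigma> E)" "wf_fm L (tr B \<sigma> E)" "wf_fm L E"
    using MAnd.prems by auto
  have C: "insert ?C ?\<Gamma> \<turnstile> ?C" and "?\<Gamma> \<turnstile> dn E ?C"
    using wf by (auto intro!: hyp)
  then have "?\<Gamma> \<turnstile> dn E (tr A \<sigma> E)" "?\<Gamma> \<turnstile> dn E (tr B \<sigma> E)"
    using dnI[OF AndE1[OF C] wf(3)] dnI[OF AndE2[OF C] wf(3)] by (blast intro: dn_bind)+
  then show ?case
    using MAnd.prems by (simp add: AndI cut1[OF _ MAnd.IH(1)] cut1[OF _ MAnd.IH(2)])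
next
  case (MImp A B)
  let ?\<Gamma> = "{tr A \<sigma> E, dn E (Imp (tr A \<sigma> E) (tr B \<sigma> E))}"
  let ?C = "Imp (tr A \<sigma> E) (tr B \<sigma> E)"
  have wf: "wf_fm L (tr A \<sigma> E)" "wf_fm L (tr B \<sigma> E)" "wf_fm L E"
    using MImp.prems by auto
  have "insert ?C ?\<Gamma> \<turnstile> ?C" "insert ?C ?\<Gamma> \<turnstile> tr A \<sigma> E" and C: "?\<Gamma> \<turnstile> dn E ?C"
    using wf by (simp_all add: Assm)
  then have "insert ?C ?\<Gamma> \<turnstile> dn E (tr B \<sigma> E)"
    using wf(3) by (blast intro: dnI ImpE)
  with C have "?\<Gamma> \<turnstile> dn E (tr B \<sigma> E)"
    by (rule dn_bind)
  then have "?\<Gamma> \<turnstile> tr B \<sigma> E"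
    using MImp.prems by (intro cut1[OF _ MImp.IH(2)]) simp_all
  then show ?case
    using wf by (simp add: ImpI)
next
  case (MAll A)
  let ?E = "subst_fm shift E"
  let ?A = "tr A (up \<sigma>) ?E"
  let ?C = "subst_fm shift (All ?A)"
  have wf: "wf_fm L ?A" "wf_fm L ?E" "wf_fm L ?C"
    using MAll.prems by auto
  have "insert ?C {dn ?E ?C} \<turnstile> All (subst_fm (up shift) ?A)" and C: "{dn ?E ?C} \<turnstile> dn ?E ?C"
    using wf by (simp_all add: Assm)
  from AllE[OF this(1), of "Var 0"] have "insert ?C {dn ?E ?C} \<turnstile> dn ?E ?A"
    using wf(2) by (simp add: dnI)
  with C have "{dn ?E ?C} \<turnstile> dn ?E ?A"
    by (rule dn_bind)
  then have "{dn ?E ?C} \<turnstile> ?A"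
    using MAll.prems by (intro cut1[OF _ MAll.IH]) simp_all
  then show ?case
    by (simp add: AllI)
next
  case MBot
  then show ?case
    by (simp add: dn_self Assm)
next
  case (MPred p ts)
  then show ?case
    by (simp add: dn_dn list_all_iff)
qed (simp_all add: dn_dn)

text \<open>By stability a translated goal is as good as a goal under \<open>dn E\<close>, so a
  double negation may be stripped from a hypothesis. The elimination rules for \<or>, \<exists>,
  equality and \<open>Box\<close> need this.\<close>

lemma tr_bind:
  assumes "\<Gamma> \<turnstile> dn E B" "insert B \<Gamma> \<turnstile> tr A \<sigma> E" "wf_mfm L A" "wf_subst L \<sigma>"
  shows "\<Gamma> \<turnstile> tr A \<sigma> E"
proof -
  have "wf_fm L E"
    using wf[OF assms(1)] by simp
  then show ?thesis
    using cut1[OF dn_bind[OF assms(1) dnI[OF assms(2)]] tr_stable] assms(3,4) by simp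
qed

section \<open>Worlds and soundness\<close>

text \<open>Admitting arbitrary well-formed instances makes the worlds closed under shifting, so
  that the translation can pass under quantifiers.\<close>

definition world :: "('f, 'p) fm \<Rightarrow> bool" where
  "world E \<longleftrightarrow> (\<exists>F\<in>set Fs. \<exists>\<tau>. wf_subst L \<tau> \<and> E = subst_fm \<tau> F)"

lemma world_wf [simp]: "world E \<Longrightarrow> wf_fm L E"
  by (auto simp: world_def wf_Fs)

lemma world_subst: "F \<in> set Fs \<Longrightarrow> wf_subst L \<tau> \<Longrightarrow> world (subst_fm \<tau> F)"
  by (auto simp: world_def)

lemma world_Fs: "F \<in> set Fs \<Longrightarrow> world F"
  using world_subst[of F Var] by simp

lemma world_shift [simp]: "world E \<Longrightarrow> world (subst_fm shift E)"
  using wf_subst_scomp[OF wf_subst_simps(2)] unfolding world_def by fastforce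

lemma everywhereI:
  assumes "\<And>F. F \<in> set Fs \<Longrightarrow> subst_fm (shiftn N) ` \<Gamma> \<turnstile> tr A (shiftn N \<odot> \<sigma>) F"
  shows "\<Gamma> \<turnstile> everywhere A \<sigma>"
  using assms by (simp add: everywhere_def conjs_iff allsI)

text \<open>\<open>F\<close> sees only the first \<open>N\<close> values of \<tau>. Instantiating
  the \<open>N\<close> quantifiers with these therefore turns \<open>F\<close> into the world
  \<open>E\<close>, while \<open>instn\<close> cancels the shift of \<sigma>.\<close>

lemma everywhereE:
  assumes "\<Gamma> \<turnstile> everywhere A \<sigma>" "world E"
  shows "\<Gamma> \<turnstile> tr A \<sigma> E"
proof -
  obtain F \<tau> where F: "F \<in> set Fs" "wf_subst L \<tau>" "E = subst_fm \<tau> F"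
    using assms(2) by (auto simp: world_def)
  have "\<Gamma> \<turnstile> alls N (tr A (shiftn N \<odot> \<sigma>) F)"
    using assms(1) F(1) by (simp add: everywhere_def conjs_iff)
  from allsE[OF this F(2)] have "\<Gamma> \<turnstile> tr A \<sigma> (subst_fm (instn N \<tau>) F)"
    by (simp add: subst_tr)
  also have "subst_fm (instn N \<tau>) F = E"
    unfolding F(3) by (rule free_belowD[OF free_Fs[OF F(1)]]) (simp add: instn_def)
  finally show ?thesis .
qed

text \<open>
  Finiteness of the context is needed for \<open>BoxI\<close>, where the double negations are
  stripped from the translated assumptions one at a time.
\<close>

lemma soundness:
  assumes MAx: "\<And>A \<sigma> E. A \<in> MAx \<Longrightarrow> wf_subst L \<sigma> \<Longrightarrow> world E \<Longrightarrow> {} \<turnstile> tr A \<sigma> E"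
    and wf_MAx: "\<forall>A\<in>MAx. wf_mfm L A"
  shows "mderiv L MAx \<Gamma> A \<Longrightarrow> finite \<Gamma> \<Longrightarrow> \<forall>B\<in>\<Gamma>. wf_mfm L B \<Longrightarrow> wf_subst L \<sigma> \<Longrightarrow> world E \<Longrightarrow>
    (\<lambda>B. tr B \<sigma> E) ` \<Gamma> \<turnstile> tr A \<sigma> E"
proof (induction arbitrary: \<sigma> E rule: mderiv.induct)
  case (MAxiom A \<Gamma>)
  then show ?case
    using weaken[OF MAx] by simp
next
  case (MAssm A \<Gamma>)
  then show ?case
    by (simp add: Assm)
next
  case (MRaa A \<Gamma>)
  then have wf: "wf_fm L (tr A \<sigma> E)" "wf_fm L E"
    by simp_all
  \<comment> \<open>\<open>MBot\<close> translates to \<open>E\<close> and \<open>MNeg A\<close> to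
    \<open>Imp (tr A \<sigma> E) E\<close>, so the induction hypothesis is already this double
    negation up to \<open>ImpI\<close>.\<close>
  have "(\<lambda>B. tr B \<sigma> E) ` \<Gamma> \<turnstile> dn E (tr A \<sigma> E)"
    using MRaa wf by (simp add: dn_def ImpI)
  then show ?case
    using MRaa.hyps(2) MRaa.prems by (intro cut1[OF _ tr_stable]) simp_all
next
  case (MOrI1 \<Gamma> A B)
  then show ?case
    by (simp add: dnI OrI1)
next
  case (MOrI2 \<Gamma> B A)
  then show ?case
    by (simp add: dnI OrI2)
next
  case (MOrE \<Gamma> A B C)
  let ?\<Gamma> = "(\<lambda>B. tr B \<sigma> E) ` \<Gamma>"
  let ?A = "tr A \<sigma> E" and ?B = "tr B \<sigma> E"
  have wf: "wf_mfm L A" "wf_mfm L B" "wf_mfm L C"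
    using mderiv_wf[OF MOrE.hyps(1) wf_MAx] mderiv_wf[OF MOrE.hyps(2) wf_MAx] by simp_all
  have A: "insert ?A (insert (Or ?A ?B) ?\<Gamma>) \<turnstile> tr C \<sigma> E"
    by (rule weaken[of "insert ?A ?\<Gamma>"]) (use wf MOrE.IH(2)[of \<sigma> E] MOrE.prems in auto)
  have B: "insert ?B (insert (Or ?A ?B) ?\<Gamma>) \<turnstile> tr C \<sigma> E"
    by (rule weaken[of "insert ?B ?\<Gamma>"]) (use wf MOrE.IH(3)[of \<sigma> E] MOrE.prems in auto)
  have "insert (Or ?A ?B) ?\<Gamma> \<turnstile> tr C \<sigma> E"
    using wf MOrE.prems by (intro OrE[OF hyp A B]) simp
  moreover have "?\<Gamma> \<turnstile> dn E (Or ?A ?B)"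
    using MOrE.IH(1)[of \<sigma> E] MOrE.prems by simp
  ultimately show ?case
    using wf MOrE.prems by (blast intro: tr_bind)
next
  case (MAndI \<Gamma> A B)
  then show ?case
    by (simp add: AndI)
next
  case (MAndE1 \<Gamma> A B)
  then show ?case
    by (simp add: AndE1[where B = "tr B \<sigma> E"])
next
  case (MAndE2 \<Gamma> A B)
  then show ?case
    by (simp add: AndE2[where A = "tr A \<sigma> E"])
next
  case (MImpI A \<Gamma> B)
  then show ?case
    by (simp add: ImpI)
next
  case (MImpE \<Gamma> A B)
  show ?case
    by (rule ImpE[of _ _ _ "tr A \<sigma> E"]) (use MImpE.IH[of \<sigma> E] MImpE.prems in simp_all)
next
  case (MExI \<Gamma> t A)
  have "(\<lambda>B. tr B \<sigma> E) ` \<Gamma> \<turnstile> Ex (tr A (up \<sigma>) (subst_fm shift E))"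
    by (rule ExI[of _ _ _ "subst_tm \<sigma> t"])
      (use MExI.IH[of \<sigma> E] MExI.prems MExI.hyps in \<open>simp_all only: tr_inst wf_subst_tm\<close>)
  then show ?case
    using MExI.prems by (simp add: dnI)
next
  case (MExE \<Gamma> A C)
  let ?\<Gamma> = "(\<lambda>B. tr B \<sigma> E) ` \<Gamma>"
  let ?A = "tr A (up \<sigma>) (subst_fm shift E)"
  have wf: "wf_mfm L A" "wf_mfm L C"
    using mderiv_wf[OF MExE.hyps(1) wf_MAx] mderiv_wf[OF MExE.hyps(2) wf_MAx]
    by (auto dest: wf_subst_mfmD)
  have "(\<lambda>B. tr B (up \<sigma>) (subst_fm shift E)) ` insert A (subst_mfm shift ` \<Gamma>)
      \<turnstile> tr (subst_mfm shift C) (up \<sigma>) (subst_fm shift E)"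
    using wf MExE.prems by (intro MExE.IH(2)) simp_all
  then have A: "insert ?A (subst_fm shift ` ?\<Gamma>) \<turnstile> subst_fm shift (tr C \<sigma> E)"
    by (simp only: image_insert image_image tr_shift)
  have "insert ?A (subst_fm shift ` insert (Ex ?A) ?\<Gamma>) \<turnstile> subst_fm shift (tr C \<sigma> E)"
    by (rule weaken[OF A]) auto
  then have "insert (Ex ?A) ?\<Gamma> \<turnstile> tr C \<sigma> E"
    using wf MExE.prems by (intro ExE[OF hyp]) simp_all
  moreover have "?\<Gamma> \<turnstile> dn E (Ex ?A)"
    using MExE.IH(1)[of \<sigma> E] MExE.prems by simp
  ultimately show ?case
    using wf MExE.prems by (blast intro: tr_bind)
next
  case (MAllI \<Gamma> A)
  have "(\<lambda>B. tr B (up \<sigma>) (subst_fm shift E)) ` (subst_mfm shift ` \<Gamma>) \<turnstile> tr A (up \<sigma>) (subst_fm shift E)"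
    using MAllI.prems by (intro MAllI.IH) simp_all
  then have "subst_fm shift ` (\<lambda>B. tr B \<sigma> E) ` \<Gamma> \<turnstile> tr A (up \<sigma>) (subst_fm shift E)"
    by (simp only: image_image tr_shift)
  then show ?case
    by (simp add: AllI)
next
  case (MAllE \<Gamma> A t)
  have "(\<lambda>B. tr B \<sigma> E) ` \<Gamma> \<turnstile> All (tr A (up \<sigma>) (subst_fm shift E))"
    using MAllE.IH[of \<sigma> E] MAllE.prems by simp
  from AllE[OF this, of "subst_tm \<sigma> t"] show ?case
    using MAllE by (simp only: tr_inst wf_subst_tm)
next
  case (MEqRefl t \<Gamma>)
  then show ?case
    by (simp add: dnI EqRefl)
next
  case (MEqSubst \<Gamma> s t A)
  let ?\<Gamma> = "(\<lambda>B. tr B \<sigma> E) ` \<Gamma>"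
  let ?e = "Eq (subst_tm \<sigma> s) (subst_tm \<sigma> t)"
  have wf: "wf_tm L s" "wf_tm L t" "wf_mfm L A"
    using mderiv_wf[OF MEqSubst.hyps(1) wf_MAx] mderiv_wf[OF MEqSubst.hyps(2) wf_MAx]
    by (auto dest: wf_subst_mfmD)
  have "?\<Gamma> \<turnstile> tr (subst_mfm (inst s) A) \<sigma> E"
    using MEqSubst.prems by (rule MEqSubst.IH)
  then have "insert ?e ?\<Gamma> \<turnstile> tr (subst_mfm (inst s) A) \<sigma> E"
    by (rule weaken) auto
  moreover have "insert ?e ?\<Gamma> \<turnstile> ?e"
    using wf MEqSubst.prems by (simp add: hyp)
  \<comment> \<open>By \<open>tr_inst\<close> both translations are instances of
    \<open>tr A (up \<sigma>) (subst_fm shift E)\<close>, so replacement of equals applies to it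
    even if \<open>A\<close> contains \<open>Box\<close>.\<close>
  ultimately have "insert ?e ?\<Gamma> \<turnstile> tr (subst_mfm (inst t) A) \<sigma> E"
    unfolding tr_inst by (rule EqSubst[rotated])
  moreover have "?\<Gamma> \<turnstile> dn E ?e"
    using MEqSubst.IH(1)[of \<sigma> E] MEqSubst.prems by simp
  ultimately show ?case
    using wf MEqSubst.prems by - (rule tr_bind, simp_all)
next
  case (BoxI \<Delta> A \<Gamma>)
  let ?\<Gamma> = "(\<lambda>B. tr B \<sigma> E) ` \<Gamma>"
  let ?X = "(\<lambda>B. everywhere B \<sigma>) ` \<Delta>"
  have fin: "finite \<Delta>"
    using finite_subset[OF BoxI.hyps(2) BoxI.prems(1)] by (rule finite_imageD) (simp add: inj_on_def)
  have wf: "\<forall>B\<in>\<Delta>. wf_mfm L B"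
    using BoxI.hyps(2) BoxI.prems(2) by fastforce
  have "?X \<turnstile> everywhere A \<sigma>"
  proof (rule everywhereI)
    fix F
    assume F: "F \<in> set Fs"
    let ?X' = "(\<lambda>B. everywhere B (shiftn N \<odot> \<sigma>)) ` \<Delta>"
    have IH: "(\<lambda>B. tr B (shiftn N \<odot> \<sigma>) F) ` Box ` \<Delta> \<turnstile> tr A (shiftn N \<odot> \<sigma>) F"
      using BoxI.prems fin wf F by (intro BoxI.IH) (simp_all add: world_Fs)
    have "?X' \<turnstile> tr A (shiftn N \<odot> \<sigma>) F"
    proof (rule cut_finite)
      show "?X' \<turnstile> B" if "B \<in> (\<lambda>B. tr B (shiftn N \<odot> \<sigma>) F) ` Box ` \<Delta>" for B
        using that wf F BoxI.prems by (auto intro!: dnI[OF Assm] simp: wf_Fs)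
      show "?X' \<union> (\<lambda>B. tr B (shiftn N \<odot> \<sigma>) F) ` Box ` \<Delta> \<turnstile> tr A (shiftn N \<odot> \<sigma>) F"
        using IH by (rule weaken) simp
    qed (simp add: fin)
    then show "subst_fm (shiftn N) ` ?X \<turnstile> tr A (shiftn N \<odot> \<sigma>) F"
      by (simp add: image_image subst_everywhere)
  qed
  then have "?\<Gamma> \<union> ?X \<turnstile> everywhere A \<sigma>"
    by (rule weaken) simp
  then have "?\<Gamma> \<union> ?X \<turnstile> dn E (everywhere A \<sigma>)"
    using BoxI.prems by (simp add: dnI)
  moreover have "?\<Gamma> \<turnstile> dn E B" if "B \<in> ?X" for B
  proof (rule Assm)
    show "dn E B \<in> ?\<Gamma>"
      using that BoxI.hyps(2) by (force simp flip: tr_Box)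
    show "wf_fm L (dn E B)"
      using that wf BoxI.prems by auto
  qed
  ultimately show ?case
    using dn_bind_finite[of ?X] fin by simp
next
  case (BoxE \<Gamma> A)
  have wf: "wf_mfm L A"
    using mderiv_wf[OF BoxE.hyps wf_MAx] by simp
  have "(\<lambda>B. tr B \<sigma> E) ` \<Gamma> \<turnstile> dn E (everywhere A \<sigma>)"
    using BoxE.IH[of \<sigma> E] BoxE.prems by simp
  then show ?case
    by (rule tr_bind) (use wf BoxE.prems in \<open>simp_all add: everywhereE hyp\<close>)
qed

section \<open>Subformulas are equivalent to their translations at all worlds\<close>

text \<open>The second half treats a single world, which suits the inductive cases;
  \<open>faithful_everywhere\<close> turns it into an equivalence. Quantifying over \<Gamma> and
  \<sigma> lets the induction pass under assumptions and quantifiers.\<close>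

definition faithful :: "('f, 'p) fm \<Rightarrow> bool" where
  "faithful A \<longleftrightarrow> wf_fm L A \<and> (\<forall>\<Gamma> \<sigma>. wf_subst L \<sigma> \<longrightarrow>
    (\<Gamma> \<turnstile> everywhere (rs A) \<sigma> \<longrightarrow> \<Gamma> \<turnstile> subst_fm \<sigma> A) \<and>
    (\<forall>E. world E \<longrightarrow> \<Gamma> \<turnstile> subst_fm \<sigma> A \<longrightarrow> \<Gamma> \<turnstile> tr (rs A) \<sigma> E))"

lemma faithfulI:
  assumes "wf_fm L A"
    and "\<And>\<Gamma> \<sigma>. wf_subst L \<sigma> \<Longrightarrow> \<Gamma> \<turnstile> everywhere (rs A) \<sigma> \<Longrightarrow> \<Gamma> \<turnstile> subst_fm \<sigma> A"
    and "\<And>\<Gamma> \<sigma> E. wf_subst L \<sigma> \<Longrightarrow> world E \<Longrightarrow> \<Gamma> \<turnstile> subst_fm \<sigma> A \<Longrightarrow> \<Gamma> \<turnstile> tr (rs A) \<sigma> E"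
  shows "faithful A"
  using assms by (simp add: faithful_def)

lemma faithful_tr:
  "faithful A \<Longrightarrow> wf_subst L \<sigma> \<Longrightarrow> world E \<Longrightarrow> \<Gamma> \<turnstile> subst_fm \<sigma> A \<Longrightarrow> \<Gamma> \<turnstile> tr (rs A) \<sigma> E"
  by (simp add: faithful_def)

text \<open>The generic world in \<open>everywhereI\<close> shifts the context by \<open>N\<close>.
  With \<open>subst_fm \<sigma> A\<close> as the only assumption this merely changes \<sigma>, and
  the first hypothesis is uniform in \<sigma>.\<close>

lemma everywhere_from:
  assumes "\<And>\<sigma> E. wf_subst L \<sigma> \<Longrightarrow> world E \<Longrightarrow> {subst_fm \<sigma> A} \<turnstile> tr B \<sigma> E"
    and "\<Gamma> \<turnstile> subst_fm \<sigma> A" "wf_subst L \<sigma>"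
  shows "\<Gamma> \<turnstile> everywhere B \<sigma>"
  using assms(2)
proof (rule cut1)
  show "{subst_fm \<sigma> A} \<turnstile> everywhere B \<sigma>"
    by (rule everywhereI) (simp add: assms(1,3) world_Fs)
qed

text \<open>Here the substitution may change as well; the universal quantifier needs the passage
  from \<open>shift \<odot> \<sigma>\<close> to \<open>up \<sigma>\<close>.\<close>

lemma everywhere_mono:
  assumes "\<Gamma> \<turnstile> everywhere A \<sigma>"
    and "\<And>F. F \<in> set Fs \<Longrightarrow> {everywhere A (shiftn N \<odot> \<sigma>)} \<turnstile> tr B (shiftn N \<odot> \<tau>) F"
  shows "\<Gamma> \<turnstile> everywhere B \<tau>"
  using assms(1)
proof (rule cut1)
  show "{everywhere A \<sigma>} \<turnstile> everywhere B \<tau>"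
    by (rule everywhereI) (simp add: assms(2) subst_everywhere)
qed

lemma faithful_wf: "faithful A \<Longrightarrow> wf_fm L A"
  by (simp add: faithful_def)

lemma wf_rs [simp]: "wf_fm L A \<Longrightarrow> wf_mfm L (rs A)"
  by (induction A) auto

lemma faithful_everywhere:
  assumes "faithful A" "wf_subst L \<sigma>"
  shows "\<Gamma> \<turnstile> everywhere (rs A) \<sigma> \<longleftrightarrow> \<Gamma> \<turnstile> subst_fm \<sigma> A"
proof
  assume "\<Gamma> \<turnstile> everywhere (rs A) \<sigma>"
  then show "\<Gamma> \<turnstile> subst_fm \<sigma> A"
    using assms by (simp add: faithful_def)
next
  assume "\<Gamma> \<turnstile> subst_fm \<sigma> A"
  then show "\<Gamma> \<turnstile> everywhere (rs A) \<sigma>"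
    using faithful_tr[OF assms(1)] assms(2) faithful_wf[OF assms(1)]
    by - (rule everywhere_from, simp_all add: hyp)
qed

text \<open>Since \<open>rs\<close> puts \<open>Box\<close> in front of immediate subformulas, the
  induction hypotheses are mostly needed below a double negation.\<close>

lemma faithful_dn:
  assumes "faithful A" "wf_subst L \<sigma>"
  shows "\<Gamma> \<turnstile> dn E (everywhere (rs A) \<sigma>) \<longleftrightarrow> \<Gamma> \<turnstile> dn E (subst_fm \<sigma> A)"
proof -
  have wfA: "wf_fm L A"
    using assms(1) by (rule faithful_wf)
  show ?thesis
  proof
    assume dn: "\<Gamma> \<turnstile> dn E (everywhere (rs A) \<sigma>)"
    then show "\<Gamma> \<turnstile> dn E (subst_fm \<sigma> A)"
      by (rule dn_bind)
        (use wfA assms wf[OF dn] in \<open>simp add: dnI hyp faithful_everywhere[symmetric]\<close>)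
  next
    assume dn: "\<Gamma> \<turnstile> dn E (subst_fm \<sigma> A)"
    then show "\<Gamma> \<turnstile> dn E (everywhere (rs A) \<sigma>)"
      by (rule dn_bind)
        (use wfA assms wf[OF dn] in \<open>simp add: dnI hyp faithful_everywhere\<close>)
  qed
qed

text \<open>At the world \<open>Bot\<close> the translation of \<open>MBot\<close> is
  \<open>Bot\<close>.\<close>

lemma faithful_Bot: "Bot \<in> set Fs \<Longrightarrow> faithful Bot"
proof (rule faithfulI)
  show "\<Gamma> \<turnstile> subst_fm \<sigma> Bot" if "Bot \<in> set Fs" "\<Gamma> \<turnstile> everywhere (rs Bot) \<sigma>" for \<Gamma> \<sigma>
    using everywhereE[OF that(2) world_Fs[OF that(1)]] by simp
qed (simp_all add: BotE)

lemma faithful_Eq: "Eq s t \<in> set Fs \<Longrightarrow> faithful (Eq s t)"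
proof (rule faithfulI)
  show "\<Gamma> \<turnstile> subst_fm \<sigma> (Eq s t)"
    if "Eq s t \<in> set Fs" "wf_subst L \<sigma>" "\<Gamma> \<turnstile> everywhere (rs (Eq s t)) \<sigma>" for \<Gamma> \<sigma>
    using everywhereE[OF that(3) world_subst[OF that(1,2)]] by - (rule dn_self, simp)
qed (use wf_Fs[of "Eq s t"] in \<open>simp_all add: dnI\<close>)

text \<open>The world \<open>?C\<close> is used twice: for the boxed formula as a whole, and again
  to open the box. The outcome is \<open>dn ?C ?C\<close>.\<close>

lemma faithful_Pred:
  assumes "Pred p ts \<in> set Fs"
  shows "faithful (Pred p ts)"
proof (rule faithfulI)
  show wf: "wf_fm L (Pred p ts)"
    using assms by (rule wf_Fs)
  show "\<Gamma> \<turnstile> subst_fm \<sigma> (Pred p ts)"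
    if \<sigma>: "wf_subst L \<sigma>" and *: "\<Gamma> \<turnstile> everywhere (rs (Pred p ts)) \<sigma>" for \<Gamma> \<sigma>
  proof -
    let ?C = "subst_fm \<sigma> (Pred p ts)"
    have world: "world ?C"
      using world_subst[OF assms \<sigma>] .
    have "\<Gamma> \<turnstile> dn ?C (everywhere (MPred p ts) \<sigma>)"
      using everywhereE[OF * world] by simp
    moreover have "insert (everywhere (MPred p ts) \<sigma>) \<Gamma> \<turnstile> everywhere (MPred p ts) \<sigma>"
      using wf \<sigma> by (intro hyp wf_everywhere) simp_all
    from everywhereE[OF this world] have "insert (everywhere (MPred p ts) \<sigma>) \<Gamma> \<turnstile> dn ?C ?C"
      by simp
    ultimately have "\<Gamma> \<turnstile> dn ?C ?C"
      by (rule dn_bind)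
    then show ?thesis
      by (rule dn_self)
  qed
  show "\<Gamma> \<turnstile> tr (rs (Pred p ts)) \<sigma> E"
    if "wf_subst L \<sigma>" "world E" "\<Gamma> \<turnstile> subst_fm \<sigma> (Pred p ts)" for \<Gamma> \<sigma> E
  proof -
    have "{subst_fm \<sigma> (Pred p ts)} \<turnstile> tr (MPred p ts) \<sigma> E" if "wf_subst L \<sigma>" "world E" for \<sigma> E
      using hyp[OF wf_subst_fm[OF that(1) wf]] that by (simp add: dnI)
    from everywhere_from[OF this that(3,1)] show ?thesis
      using that by (simp add: dnI)
  qed
qed

text \<open>At the world \<open>?C\<close>, the disjunction itself, the goal absorbs every double
  negation: each translated disjunct amounts to \<open>dn ?C ?A\<close> or \<open>dn ?C ?B\<close>,
  and \<open>?A\<close> and \<open>?B\<close> both imply \<open>?C\<close>.\<close>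

lemma faithful_Or:
  assumes "Or A B \<in> set Fs" and A: "faithful A" and B: "faithful B"
  shows "faithful (Or A B)"
proof (rule faithfulI)
  have wf: "wf_fm L A" "wf_fm L B"
    using A B by (simp_all add: faithful_wf)
  then show "wf_fm L (Or A B)"
    by simp
  show "\<Gamma> \<turnstile> subst_fm \<sigma> (Or A B)"
    if \<sigma>: "wf_subst L \<sigma>" and *: "\<Gamma> \<turnstile> everywhere (rs (Or A B)) \<sigma>" for \<Gamma> \<sigma>
  proof -
    let ?A = "subst_fm \<sigma> A" and ?B = "subst_fm \<sigma> B"
    let ?C = "Or ?A ?B"
    let ?X = "dn ?C (everywhere (rs A) \<sigma>)" and ?Y = "dn ?C (everywhere (rs B) \<sigma>)"
    have wfXY: "wf_fm L ?X" "wf_fm L ?Y" "wf_fm L ?A" "wf_fm L ?B"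
      using wf \<sigma> by simp_all
    have X: "insert ?X \<Delta> \<turnstile> ?C" for \<Delta>
    proof (rule dnE)
      show "insert ?X \<Delta> \<turnstile> dn ?C ?A"
        using wfXY(1) by (simp add: hyp flip: faithful_dn[OF A \<sigma>])
      show "insert ?A (insert ?X \<Delta>) \<turnstile> ?C"
        using wfXY by (simp add: OrI1 hyp)
    qed
    have Y: "insert ?Y \<Delta> \<turnstile> ?C" for \<Delta>
    proof (rule dnE)
      show "insert ?Y \<Delta> \<turnstile> dn ?C ?B"
        using wfXY(2) by (simp add: hyp flip: faithful_dn[OF B \<sigma>])
      show "insert ?B (insert ?Y \<Delta>) \<turnstile> ?C"
        using wfXY by (simp add: OrI2 hyp)
    qed
    have "insert (Or ?X ?Y) \<Gamma> \<turnstile> ?C"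
      by (rule OrE[OF hyp X Y]) (simp only: wf_fm.simps wfXY simp_thms)
    moreover have "\<Gamma> \<turnstile> dn ?C (Or ?X ?Y)"
      using everywhereE[OF * world_subst[OF assms(1) \<sigma>]] by simp
    ultimately show ?thesis
      unfolding subst_fm.simps by (rule dnE[rotated])
  qed
  show "\<Gamma> \<turnstile> tr (rs (Or A B)) \<sigma> E"
    if \<sigma>: "wf_subst L \<sigma>" and "world E" and *: "\<Gamma> \<turnstile> subst_fm \<sigma> (Or A B)" for \<Gamma> \<sigma> E
  proof -
    let ?X = "dn E (everywhere (rs A) \<sigma>)" and ?Y = "dn E (everywhere (rs B) \<sigma>)"
    have "insert (subst_fm \<sigma> A) \<Gamma> \<turnstile> Or ?X ?Y" "insert (subst_fm \<sigma> B) \<Gamma> \<turnstile> Or ?X ?Y"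
      using wf \<sigma> \<open>world E\<close>
      by (simp_all add: OrI1 OrI2 dnI hyp faithful_dn[OF A] faithful_dn[OF B])
    with * have "\<Gamma> \<turnstile> Or ?X ?Y"
      unfolding subst_fm.simps by (rule OrE)
    then show ?thesis
      using \<open>world E\<close> by (simp add: dnI)
  qed
qed

text \<open>\<open>rs\<close> commutes with conjunction, so it suffices to split the conjunction at
  each world.\<close>

lemma faithful_And:
  assumes A: "faithful A" and B: "faithful B"
  shows "faithful (And A B)"
proof (rule faithfulI)
  have wf: "wf_fm L A" "wf_fm L B"
    using A B by (simp_all add: faithful_wf)
  then show "wf_fm L (And A B)"
    by simp
  show "\<Gamma> \<turnstile> subst_fm \<sigma> (And A B)"
    if \<sigma>: "wf_subst L \<sigma>" and *: "\<Gamma> \<turnstile> everywhere (rs (And A B)) \<sigma>" for \<Gamma> \<sigma>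
  proof -
    let ?V = "everywhere (rs (And A B)) (shiftn N \<odot> \<sigma>)"
    have V: "{?V} \<turnstile> And (tr (rs A) (shiftn N \<odot> \<sigma>) F) (tr (rs B) (shiftn N \<odot> \<sigma>) F)"
      if "F \<in> set Fs" for F
      using everywhereE[OF hyp world_Fs[OF that], of "rs (And A B)" "shiftn N \<odot> \<sigma>" "{}"] wf \<sigma>
      by simp
    have "\<Gamma> \<turnstile> everywhere (rs A) \<sigma>" "\<Gamma> \<turnstile> everywhere (rs B) \<sigma>"
      using everywhere_mono[OF * AndE1[OF V]] everywhere_mono[OF * AndE2[OF V]] by blast+
    then show ?thesis
      using A B \<sigma> by (simp add: AndI faithful_everywhere)
  qed
  show "\<Gamma> \<turnstile> tr (rs (And A B)) \<sigma> E"
    if "wf_subst L \<sigma>" "world E" "\<Gamma> \<turnstile> subst_fm \<sigma> (And A B)" for \<Gamma> \<sigma> E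
    using that AndE1[of L Ax \<Gamma> "subst_fm \<sigma> A"] AndE2[of L Ax \<Gamma> _ "subst_fm \<sigma> B"] A B
    by (auto intro!: AndI faithful_tr)
qed

lemma faithful_Imp:
  assumes Fs: "Imp A B \<in> set Fs" "B \<in> set Fs" and A: "faithful A" and B: "faithful B"
  shows "faithful (Imp A B)"
proof (rule faithfulI)
  have wf: "wf_fm L A" "wf_fm L B"
    using A B by (simp_all add: faithful_wf)
  then show "wf_fm L (Imp A B)"
    by simp
  let ?M = "MImp (Box (rs A)) (Box (rs B))"
  show "\<Gamma> \<turnstile> subst_fm \<sigma> (Imp A B)"
    if \<sigma>: "wf_subst L \<sigma>" and *: "\<Gamma> \<turnstile> everywhere (rs (Imp A B)) \<sigma>" for \<Gamma> \<sigma>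
  proof -
    let ?A = "subst_fm \<sigma> A" and ?B = "subst_fm \<sigma> B"
    have wf': "wf_fm L ?A" "wf_fm L ?B"
      using wf \<sigma> by simp_all
    let ?\<Delta> = "insert ?A (insert (everywhere ?M \<sigma>) \<Gamma>)"
    have "?\<Delta> \<turnstile> everywhere ?M \<sigma>"
      using wf \<sigma> by (intro Assm wf_everywhere) simp_all
    \<comment> \<open>The implication is evaluated at its conclusion \<open>?B\<close>, where the
      translated conclusion becomes \<open>dn ?B ?B\<close> and hence \<open>?B\<close>. The world
      \<open>Imp ?A ?B\<close> serves afterwards to remove the outer box.\<close>
    from everywhereE[OF this world_subst[OF Fs(2) \<sigma>]]
    have "?\<Delta> \<turnstile> Imp (dn ?B (everywhere (rs A) \<sigma>)) (dn ?B (everywhere (rs B) \<sigma>))"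
      by simp
    moreover have "?\<Delta> \<turnstile> dn ?B (everywhere (rs A) \<sigma>)"
      using A \<sigma> wf' by (simp add: faithful_dn dnI hyp)
    ultimately have "?\<Delta> \<turnstile> dn ?B (everywhere (rs B) \<sigma>)"
      by (rule ImpE)
    then have "?\<Delta> \<turnstile> ?B"
      using B \<sigma> by - (rule dn_self, simp add: faithful_dn)
    then have "insert (everywhere ?M \<sigma>) \<Gamma> \<turnstile> Imp ?A ?B"
      using wf' by (simp add: ImpI)
    moreover have "\<Gamma> \<turnstile> dn (Imp ?A ?B) (everywhere ?M \<sigma>)"
      using everywhereE[OF * world_subst[OF Fs(1) \<sigma>]] by simp
    ultimately show ?thesis
      unfolding subst_fm.simps by (rule dnE[rotated])
  qed
  show "\<Gamma> \<turnstile> tr (rs (Imp A B)) \<sigma> E"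
    if "wf_subst L \<sigma>" "world E" "\<Gamma> \<turnstile> subst_fm \<sigma> (Imp A B)" for \<Gamma> \<sigma> E
  proof -
    have "{subst_fm \<sigma> (Imp A B)} \<turnstile> tr ?M \<sigma> E" if \<sigma>: "wf_subst L \<sigma>" and E: "world E" for \<sigma> E
    proof -
      let ?A = "subst_fm \<sigma> A" and ?B = "subst_fm \<sigma> B"
      let ?X = "dn E (everywhere (rs A) \<sigma>)"
      let ?\<Delta> = "insert ?X {Imp ?A ?B}"
      have wf': "wf_fm L ?A" "wf_fm L ?B" "wf_fm L E" "wf_fm L ?X"
        using wf \<sigma> E by simp_all
      have "?\<Delta> \<turnstile> dn E ?A"
        using wf'(4) by (simp add: hyp flip: faithful_dn[OF A \<sigma>])
      moreover have "insert ?A ?\<Delta> \<turnstile> dn E ?B"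
        using wf' by (intro dnI ImpE[OF Assm Assm, of ?A]) simp_all
      ultimately have "?\<Delta> \<turnstile> dn E ?B"
        by (rule dn_bind)
      then show ?thesis
        using wf'(4) B \<sigma> by (simp add: ImpI faithful_dn del: wf_dn)
    qed
    from everywhere_from[OF this that(3,1)] show ?thesis
      using that by (simp add: dnI)
  qed
qed

lemma faithful_Ex:
  assumes Fs: "Ex A \<in> set Fs" and A: "faithful A"
  shows "faithful (Ex A)"
proof (rule faithfulI)
  have wf: "wf_fm L A"
    using A by (simp add: faithful_wf)
  then show "wf_fm L (Ex A)"
    by simp
  show "\<Gamma> \<turnstile> subst_fm \<sigma> (Ex A)"
    if \<sigma>: "wf_subst L \<sigma>" and *: "\<Gamma> \<turnstile> everywhere (rs (Ex A)) \<sigma>" for \<Gamma> \<sigma>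
  proof -
    let ?A = "subst_fm (up \<sigma>) A"
    let ?C = "Ex ?A"
    let ?C' = "subst_fm shift ?C"
    let ?X = "dn ?C' (everywhere (rs A) (up \<sigma>))"
    have wf': "wf_fm L ?A" "wf_fm L ?C" "wf_fm L ?C'" "wf_fm L ?X"
      using wf \<sigma> by simp_all
    have "insert ?X \<Delta> \<turnstile> ?C'" for \<Delta>
    proof (rule dnE)
      show "insert ?X \<Delta> \<turnstile> dn ?C' ?A"
        using wf'(4) \<sigma> by (simp add: hyp flip: faithful_dn[OF A] del: subst_fm.simps wf_dn)
      \<comment> \<open>The eigenvariable of \<open>ExE\<close> is the witness; the goal is the
        shifted world \<open>?C'\<close>, at which the body was translated.\<close>
      have "insert ?A (insert ?X \<Delta>) \<turnstile> subst_fm (inst (Var 0)) (subst_fm (up shift) ?A)"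
        using wf' by (simp add: hyp)
      from ExI[OF this] show "insert ?A (insert ?X \<Delta>) \<turnstile> ?C'"
        by simp
    qed
    then have "insert (Ex ?X) \<Gamma> \<turnstile> ?C"
      using wf'(4) by (intro ExE[OF hyp]) simp_all
    moreover have "\<Gamma> \<turnstile> dn ?C (Ex ?X)"
      using everywhereE[OF * world_subst[OF Fs \<sigma>]] by simp
    ultimately show ?thesis
      unfolding subst_fm.simps by (rule dnE[rotated])
  qed
  show "\<Gamma> \<turnstile> tr (rs (Ex A)) \<sigma> E"
    if \<sigma>: "wf_subst L \<sigma>" and E: "world E" and *: "\<Gamma> \<turnstile> subst_fm \<sigma> (Ex A)" for \<Gamma> \<sigma> E
  proof -
    let ?A = "subst_fm (up \<sigma>) A"
    let ?X = "dn (subst_fm shift E) (everywhere (rs A) (up \<sigma>))"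
    have "insert ?A (subst_fm shift ` \<Gamma>) \<turnstile> ?X"
      using wf \<sigma> E by (simp add: faithful_dn[OF A] dnI hyp)
    then have "insert ?A (subst_fm shift ` \<Gamma>) \<turnstile> subst_fm (inst (Var 0)) (subst_fm (up shift) ?X)"
      by (simp only: subst_fm_scomp inst_up_shift subst_fm_Var)
    from ExI[OF this] have "insert ?A (subst_fm shift ` \<Gamma>) \<turnstile> subst_fm shift (Ex ?X)"
      by simp
    with * have "\<Gamma> \<turnstile> Ex ?X"
      unfolding subst_fm.simps(7)[of \<sigma>] by (rule ExE)
    then show ?thesis
      using E by (simp add: dnI)
  qed
qed

text \<open>\<open>rs\<close> commutes with the quantifier, so no particular world has to be chosen.
  The work lies in exchanging this quantifier with the \<open>N\<close> quantifiers inside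
  \<open>everywhere\<close>.\<close>

lemma faithful_All:
  assumes A: "faithful A"
  shows "faithful (All A)"
proof (rule faithfulI)
  have wf: "wf_fm L A"
    using A by (simp add: faithful_wf)
  then show "wf_fm L (All A)"
    by simp
  show "\<Gamma> \<turnstile> subst_fm \<sigma> (All A)"
    if \<sigma>: "wf_subst L \<sigma>" and *: "\<Gamma> \<turnstile> everywhere (rs (All A)) \<sigma>" for \<Gamma> \<sigma>
    using *
  proof (rule cut1)
    let ?V = "\<lambda>\<sigma>. everywhere (rs (All A)) \<sigma>"
    have V: "{?V (shift \<odot> \<sigma>)} \<turnstile> ?V (shift \<odot> \<sigma>)"
      using wf \<sigma> by (simp add: hyp)
    have "{?V (shift \<odot> \<sigma>)} \<turnstile> everywhere (rs A) (up \<sigma>)"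
      using V
    proof (rule everywhere_mono)
      fix F
      assume F: "F \<in> set Fs"
      let ?\<rho> = "shiftn N \<odot> (shift \<odot> \<sigma>)"
      have "{?V ?\<rho>} \<turnstile> tr (rs (All A)) ?\<rho> F"
        using wf \<sigma> F by (intro everywhereE[OF hyp] world_Fs wf_everywhere) simp_all
      then have "{?V ?\<rho>} \<turnstile> All (tr (rs A) (up ?\<rho>) (subst_fm shift F))"
        by simp
      \<comment> \<open>Behind the \<open>N\<close> variables of the generic world the eigenvariable
        has index \<open>N\<close>; this is where \<open>shiftn N\<close> sends
        \<open>Var 0\<close>.\<close>
      from AllE[OF this, of "Var N"] have "{?V ?\<rho>} \<turnstile> tr (rs A) (inst (Var N) \<odot> up ?\<rho>) F"
        by (simp add: subst_tr)
      also have "inst (Var N) \<odot> up ?\<rho> = shiftn N \<odot> up \<sigma>"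
      proof
        fix k
        show "(inst (Var N) \<odot> up ?\<rho>) k = (shiftn N \<odot> up \<sigma>) k"
        proof (cases k)
          case 0
          then show ?thesis
            by (simp add: scomp_def shiftn_def)
        next
          case (Suc m)
          then show ?thesis
            by (simp add: scomp_def[of _ "up _"]) (simp add: scomp_def)
        qed
      qed
      finally show "{?V ?\<rho>} \<turnstile> tr (rs A) (shiftn N \<odot> up \<sigma>) F" .
    qed
    then have "{?V (shift \<odot> \<sigma>)} \<turnstile> subst_fm (up \<sigma>) A"
      using A \<sigma> by (simp add: faithful_everywhere)
    then show "{?V \<sigma>} \<turnstile> subst_fm \<sigma> (All A)"
      by (simp add: AllI subst_everywhere)
  qed
  show "\<Gamma> \<turnstile> tr (rs (All A)) \<sigma> E"
    if \<sigma>: "wf_subst L \<sigma>" and E: "world E" and *: "\<Gamma> \<turnstile> subst_fm \<sigma> (All A)" for \<Gamma> \<sigma> E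
    using *
  proof (rule cut1)
    let ?A = "subst_fm (up \<sigma>) A"
    have "{subst_fm shift (All ?A)} \<turnstile> All (subst_fm (up shift) ?A)"
      using wf \<sigma> by (simp add: hyp)
    from AllE[OF this, of "Var 0"] have "{subst_fm shift (All ?A)} \<turnstile> ?A"
      by simp
    then have "{subst_fm shift (All ?A)} \<turnstile> tr (rs A) (up \<sigma>) (subst_fm shift E)"
      using A \<sigma> E by (simp add: faithful_tr)
    then show "{subst_fm \<sigma> (All A)} \<turnstile> tr (rs (All A)) \<sigma> E"
      by (simp add: AllI)
  qed
qed

end

section \<open>Reflection for arbitrary non-logical axioms\<close>

primrec subfms :: "('f, 'p) fm \<Rightarrow> ('f, 'p) fm list" where
  "subfms Bot = [Bot]"
| "subfms (Eq s t) = [Eq s t]"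
| "subfms (Pred p ts) = [Pred p ts]"
| "subfms (Or A B) = Or A B # subfms A @ subfms B"
| "subfms (And A B) = And A B # subfms A @ subfms B"
| "subfms (Imp A B) = Imp A B # subfms A @ subfms B"
| "subfms (Ex A) = Ex A # subfms A"
| "subfms (All A) = All A # subfms A"

lemma self_subfms: "A \<in> set (subfms A)"
  by (cases A) auto

lemma wf_subfms: "wf_fm L A \<Longrightarrow> B \<in> set (subfms A) \<Longrightarrow> wf_fm L B"
  by (induction A) auto

lemma (in relative_translation) faithful_subfms:
  "set (subfms A) \<subseteq> set Fs \<Longrightarrow> Bot \<in> set Fs \<Longrightarrow> faithful A"
proof (induction A)
  case (Imp A B)
  then show ?case
    using self_subfms[of B] by (intro faithful_Imp) auto
qed (simp_all add: faithful_Bot faithful_Eq faithful_Pred faithful_Or faithful_And faithful_Ex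
    faithful_All)

text \<open>Common to both halves of the final result. The modal axioms enter only through the
  derivability of their translations, which is required for all \<open>Fs\<close> and
  \<open>N\<close> because these are chosen from \<open>A\<close> inside the proof.\<close>

theorem rs_reflects_derivability:
  assumes A: "wf_fm L A" "mderiv L MAx {} (rs A)"
    and wf_axs: "\<forall>B\<in>Ax. wf_fm L B" "\<forall>B\<in>MAx. wf_mfm L B"
    and Ax: "\<And>Fs N B \<sigma> E. relative_translation L Ax Fs N \<Longrightarrow> B \<in> MAx \<Longrightarrow> wf_subst L \<sigma> \<Longrightarrow>
      wf_fm L E \<Longrightarrow> ideriv L Ax {} (relative_translation.tr Fs N B \<sigma> E)"
  shows "ideriv L Ax {} A"
proof -
  define Fs where "Fs = Bot # subfms A"
  obtain N where N: "\<forall>F\<in>set Fs. free_below N (\<lambda>\<sigma>. subst_fm \<sigma> F)"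
    using free_below_common[of Fs "\<lambda>F \<sigma>. subst_fm \<sigma> F"] ex_free_below_fm by blast
  interpret relative_translation L Ax Fs N
    using N wf_subfms[OF A(1)] wf_axs(1) by unfold_locales (auto simp: Fs_def)
  have AFs: "A \<in> set Fs"
    by (simp add: Fs_def self_subfms)
  have "faithful A"
    by (rule faithful_subfms) (auto simp: Fs_def)
  \<comment> \<open>The boxed formula translates at the world \<open>A\<close> to
    \<open>dn A (everywhere (rs A) Var)\<close>, which faithfulness turns into
    \<open>dn A A\<close>.\<close>
  have "mderiv L MAx {} (Box (rs A))"
    using BoxI[of L MAx "{}"] A(2) by simp
  then have "(\<lambda>B. tr B Var A) ` {} \<turnstile> tr (Box (rs A)) Var A"
    using Ax[OF relative_translation_axioms] wf_axs(2)
    by - (rule soundness, simp_all add: world_Fs[OF AFs])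
  then have "{} \<turnstile> dn A A"
    using faithful_dn[OF \<open>faithful A\<close>, of Var] by simp
  then show ?thesis
    by (rule dn_self)
qed

section \<open>The arithmetical axioms\<close>

lemma wf_subst_step: "wf_subst arith_lang step"
  by (auto simp: wf_subst_def step_def arith_lang_def split: nat.split)

lemma wf_HA_axioms: "\<forall>A\<in>HA_axioms. wf_fm arith_lang A"
proof
  show "wf_fm arith_lang A" if "A \<in> HA_axioms" for A
    using that
  proof cases
    case (7 A)
    have "wf_subst arith_lang (inst zero)"
      by (simp add: arith_lang_def)
    then show ?thesis
      using 7 wf_subst_step by simp
  qed (simp_all add: arith_lang_def)
qed

lemma wf_EA_axioms: "\<forall>A\<in>EA_axioms. wf_mfm arith_lang A"
proof
  show "wf_mfm arith_lang A" if "A \<in> EA_axioms" for A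
    using that
  proof cases
    case (7 A)
    have "wf_subst arith_lang (inst zero)"
      by (simp add: arith_lang_def)
    then show ?thesis
      using 7 wf_subst_step by simp
  qed (simp_all add: arith_lang_def)
qed

lemma step_shift: "step \<odot> shift = shift"
  by (rule ext) (simp add: scomp_def step_def)

text \<open>\<open>step\<close> acts on index 0 alone, whereas \<open>up \<sigma>\<close> fixes
  index 0 and sends the other variables to terms without it.\<close>

lemma step_up: "step \<odot> up \<sigma> = up \<sigma> \<odot> step"
proof
  show "(step \<odot> up \<sigma>) n = (up \<sigma> \<odot> step) n" for n
    by (cases n) (simp_all add: scomp_def[of step "up _"] scomp_def[of "up _"] step_def step_shift)
qed

abbreviation HA_deriv :: "(arith_fun, unit) fm set \<Rightarrow> (arith_fun, unit) fm \<Rightarrow> bool"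
  (infix \<open>\<turnstile>\<^sub>H\<^sub>A\<close> 50) where
  "\<Gamma> \<turnstile>\<^sub>H\<^sub>A A \<equiv> ideriv arith_lang HA_axioms \<Gamma> A"

lemma tr_EA_axioms:
  assumes "relative_translation arith_lang HA_axioms Fs N" "A \<in> EA_axioms"
    and \<sigma>: "wf_subst arith_lang \<sigma>" and E: "wf_fm arith_lang E"
  shows "{} \<turnstile>\<^sub>H\<^sub>A relative_translation.tr Fs N A \<sigma> E"
proof -
  interpret relative_translation arith_lang HA_axioms Fs N
    by (rule assms(1))
  have [simp]: "(FZero, 0) \<in> fst arith_lang" "(FSuc, Suc 0) \<in> fst arith_lang"
    by (simp_all add: arith_lang_def)
  \<comment> \<open>These instances give back the bodies of the axioms to which they are applied,
    since only index 0, or indices 0 and 1, occur there.\<close>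
  have AllE1: "\<Gamma> \<turnstile>\<^sub>H\<^sub>A subst_fm (inst (Var 0)) B" if "All B \<in> HA_axioms" for \<Gamma> B
    by (rule AllE[OF Axiom[OF that]]) simp
  have AllE2: "\<Gamma> \<turnstile>\<^sub>H\<^sub>A subst_fm (inst (Var 0)) (subst_fm (up (inst (Var 1))) B)"
    if "All (All B) \<in> HA_axioms" for \<Gamma> B
    using AllE[OF AllE[OF Axiom[OF that], where t = "Var 1", unfolded subst_fm.simps], where t = "Var 0"] by simp
  show ?thesis
    using assms(2)
  proof cases
    case 1
    let ?e = "Eq (succ (Var 0)) zero"
    let ?E = "subst_fm shift E"
    \<comment> \<open>The negation translates to \<open>Imp (dn ?E ?e) ?E\<close>. As
      \<open>?e\<close> refutes itself in arithmetic, it yields \<open>?E\<close> by ex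
      falso.\<close>
    have "{dn ?E ?e} \<turnstile>\<^sub>H\<^sub>A ?E"
    proof (rule dnE[OF hyp])
      have "insert ?e {dn ?E ?e} \<turnstile>\<^sub>H\<^sub>A Neg ?e"
        using AllE1[OF HA_axioms.intros(1)] by simp
      then have "insert ?e {dn ?E ?e} \<turnstile>\<^sub>H\<^sub>A Bot"
        by (rule ImpE) (simp add: hyp)
      then show "insert ?e {dn ?E ?e} \<turnstile>\<^sub>H\<^sub>A ?E"
        using E by (simp add: BotE)
    qed (use E in simp)
    then show ?thesis
      using 1 E by (simp add: AllI ImpI)
  next
    case 2
    let ?d = "Eq (succ (Var 1)) (succ (Var 0))" and ?e = "Eq (Var 1) (Var 0)"
    let ?E = "subst_fm shift (subst_fm shift E)"
    have wfd: "wf_fm arith_lang (dn ?E ?d)"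
      using E by simp
    have "{dn ?E ?d} \<turnstile>\<^sub>H\<^sub>A dn ?E ?e"
    proof (rule dn_bind[OF hyp])
      have "insert ?d {dn ?E ?d} \<turnstile>\<^sub>H\<^sub>A Imp ?d ?e"
        using AllE2[OF HA_axioms.intros(2)] by simp
      then have "insert ?d {dn ?E ?d} \<turnstile>\<^sub>H\<^sub>A ?e"
        by (rule ImpE) (simp add: hyp)
      then show "insert ?d {dn ?E ?d} \<turnstile>\<^sub>H\<^sub>A dn ?E ?e"
        using E by (simp add: dnI)
    qed (use wfd in simp)
    then show ?thesis
      using 2 wfd by (simp add: AllI ImpI)
  next
    case 3
    show ?thesis
      using 3 AllE1[OF HA_axioms.intros(3)] E by (simp add: AllI dnI)
  next
    case 4
    show ?thesis
      using 4 AllE2[OF HA_axioms.intros(4)] E by (simp add: AllI dnI)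
  next
    case 5
    show ?thesis
      using 5 AllE1[OF HA_axioms.intros(5)] E by (simp add: AllI dnI)
  next
    case 6
    show ?thesis
      using 6 AllE2[OF HA_axioms.intros(6)] E by (simp add: AllI dnI)
  next
    case (7 B)
    let ?B = "tr B (up \<sigma>) (subst_fm shift E)"
    \<comment> \<open>Base and step translate to instances of the one arithmetical formula
      \<open>?B\<close>, so the whole axiom becomes the induction axiom for \<open>?B\<close>, even
      if \<open>B\<close> contains \<open>Box\<close>.\<close>
    have "tr (subst_mfm (inst zero) B) \<sigma> E = subst_fm (inst zero) ?B"
      by (simp add: tr_inst)
    moreover have "tr (subst_mfm step B) (up \<sigma>) (subst_fm shift E) = subst_fm step ?B"
      by (simp add: tr_subst subst_tr step_up step_shift)
    ultimately show ?thesis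
      using 7 \<sigma> E by (simp add: Axiom HA_axioms.intros(7))
  qed
qed

theorem theorem2p2:
  fixes L :: "('f, 'p) lang"
  shows "(\<forall>A. wf_fm L A \<longrightarrow> EQC L (rs A) \<longrightarrow> IQC L A) \<and>
    (\<forall>A. wf_fm arith_lang A \<longrightarrow> EA (rs A) \<longrightarrow> HA A)"
proof (intro conjI allI impI)
  show "IQC L A" if "wf_fm L A" "EQC L (rs A)" for A
    using that rs_reflects_derivability[of L A "{}" "{}"] by (simp add: IQC_def EQC_def)
  show "HA A" if "wf_fm arith_lang A" "EA (rs A)" for A
    using that rs_reflects_derivability[OF _ _ wf_HA_axioms wf_EA_axioms tr_EA_axioms]
    by (simp add: HA_def EA_def)
qed

end
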